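(* Let $m,d$ be positive integers and let $g$ be a monic polynomial of degree $d$ over $\mathbb{F}_q$ with factorization $g=\phi_1^{e_1}\cdots\phi_t^{e_t}$ into distinct monic irreducible polynomials $\phi_i$ with $\deg\phi_i=d_i$ ($1\le i\le t$). Let $\mathcal{I}$ be the $m$-tuple $(g,\ldots,g)$. Then $$\sigma(m,d;\mathcal{I})=\frac{q^{m^2d}}{\gamma_q(m)}\prod_{i=1}^t\prod_{j=1}^m\left(1-q^{-jd_i}\right).$$
   Context: For a linear operator $T$ on an $md$-dimensional $\mathbb{F}_q$-space $V$, an $m$-dimensional subspace $W$ is $T$-splitting if $V=W\oplus TW\oplus\cdots\oplus T^{d-1}W$. For an $m$-tuple $(p_1,\ldots,p_m)$ of monic polynomials with $p_i\mid p_{i+1}$ and $\deg(p_1\cdots p_m)=md$, $\sigma(m,d;(p_1,\ldots,p_m))$ is the number of $m$-dimensional $T$-splitting subspaces for any linear operator $T$ on an $md$-dimensional space whose invariant factors (those of $xI-A$, $A$ a matrix of $T$) are $(1,\ldots,1,p_1,\ldots,p_m)$ with $m(d-1)$ ones; this number does not depend on the choice of $T$. $\gamma_q(m)=\prod_{i=0}^{m-1}(q^m-q^i)$. *)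

theory Defs
  imports "HOL-Library.Cardinality" "Jordan_Normal_Form.Char_Poly"
begin

text \<open>
  The finite field is a type \<open>'a :: {field, finite}\<close> with \<open>q = CARD('a)\<close>; the vector space \<open>V\<close> is a
  type \<open>'v\<close> whose scalar multiplication \<open>scale\<close> satisfies \<open>vector_space scale\<close>.
\<close>

text \<open>Each vector has exactly one decomposition with components in the \<open>U i\<close>, \<open>i < d\<close>.\<close>

definition is_direct_sum :: "nat \<Rightarrow> (nat \<Rightarrow> 'v::ab_group_add set) \<Rightarrow> bool" where
  "is_direct_sum d U \<longleftrightarrow> (\<forall>v. \<exists>!w. w \<in> (\<Pi>\<^sub>E i\<in>{..<d}. U i) \<and> v = (\<Sum>i<d. w i))"

definition splitting_subspace ::
    "('a::field \<Rightarrow> 'v::ab_group_add \<Rightarrow> 'v) \<Rightarrow> ('v \<Rightarrow> 'v) \<Rightarrow> nat \<Rightarrow> nat \<Rightarrow> 'v set \<Rightarrow> bool" where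
  "splitting_subspace scale T m d W \<longleftrightarrow>
     module.subspace scale W \<and> vector_space.dim scale W = m \<and>
     is_direct_sum d (\<lambda>i. (T ^^ i) ` W)"

text \<open>\<open>A\<close> is the matrix of \<open>T\<close> with respect to the ordered basis \<open>bs\<close> (columns are the images of the
  basis vectors).\<close>

definition matrix_of_operator ::
    "('a::field \<Rightarrow> 'v::ab_group_add \<Rightarrow> 'v) \<Rightarrow> 'v list \<Rightarrow> ('v \<Rightarrow> 'v) \<Rightarrow> 'a mat \<Rightarrow> bool" where
  "matrix_of_operator scale bs T A \<longleftrightarrow>
     distinct bs \<and> \<not> module.dependent scale (set bs) \<and> module.span scale (set bs) = UNIV \<and>
     A \<in> carrier_mat (length bs) (length bs) \<and>
     (\<forall>j<length bs. T (bs ! j) = (\<Sum>i<length bs. scale (A $$ (i, j)) (bs ! i)))"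

text \<open>\<open>fs\<close> is the diagonal of the Smith normal form of the square polynomial matrix \<open>M\<close>.  Requiring
  all entries to be monic, hence nonzero, restricts this to nonsingular \<open>M\<close>, such as \<open>xI - A\<close>.\<close>

definition is_invariant_factors :: "'a::field poly mat \<Rightarrow> 'a poly list \<Rightarrow> bool" where
  "is_invariant_factors M fs \<longleftrightarrow>
     M \<in> carrier_mat (length fs) (length fs) \<and>
     (\<forall>f\<in>set fs. lead_coeff f = 1) \<and>
     (\<forall>i. Suc i < length fs \<longrightarrow> fs ! i dvd fs ! Suc i) \<and>
     (\<exists>P Q. P \<in> carrier_mat (length fs) (length fs) \<and> invertible_mat P \<and>
            Q \<in> carrier_mat (length fs) (length fs) \<and> invertible_mat Q \<and>
            P * M * Q = mat_diag (length fs) (\<lambda>i. fs ! i))"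

text \<open>\<open>char_poly_matrix A\<close> is \<open>xI - A\<close>; its invariant factors do not depend on the basis \<open>bs\<close>.\<close>

definition operator_invariant_factors ::
    "('a::field \<Rightarrow> 'v::ab_group_add \<Rightarrow> 'v) \<Rightarrow> ('v \<Rightarrow> 'v) \<Rightarrow> 'a poly list \<Rightarrow> bool" where
  "operator_invariant_factors scale T fs \<longleftrightarrow>
     (\<exists>bs A. matrix_of_operator scale bs T A \<and> is_invariant_factors (char_poly_matrix A) fs)"

definition has_invariant_tuple ::
    "('a::field \<Rightarrow> 'v::ab_group_add \<Rightarrow> 'v) \<Rightarrow> nat \<Rightarrow> nat \<Rightarrow> 'a poly list \<Rightarrow> ('v \<Rightarrow> 'v) \<Rightarrow> bool" where
  "has_invariant_tuple scale m d ps T \<longleftrightarrow>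
     Vector_Spaces.linear scale scale T \<and>
     operator_invariant_factors scale T (replicate (m * (d - 1)) 1 @ ps)"

text \<open>The common number of splitting subspaces of all operators with the given invariant factors.
  The space \<open>V\<close> enters through \<open>scale\<close> and is meant to have dimension \<open>m * d\<close>.  The description is
  meaningful only if such an operator exists and the count is the same for all of them.\<close>

definition sigma ::
    "('a::field \<Rightarrow> 'v::ab_group_add \<Rightarrow> 'v) \<Rightarrow> nat \<Rightarrow> nat \<Rightarrow> 'a poly list \<Rightarrow> nat" where
  "sigma scale m d ps =
     (THE N. \<forall>T. has_invariant_tuple scale m d ps T \<longrightarrow>
               card {W. splitting_subspace scale T m d W} = N)"

definition gamma :: "nat \<Rightarrow> nat \<Rightarrow> real" where
  "gamma q m = (\<Prod>i<m. real q ^ m - real q ^ i)"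

end

theory Submission
  imports Defs
begin

text \<open>A tuple \<open>w\<^bsub>1\<^esub>, \<dots>, w\<^bsub>m\<^esub>\<close> is a basis of a splitting subspace iff it generates \<open>V\<close> as a module over
  \<open>F[x]\<close>, so the number of splitting subspaces is the number of generating \<open>m\<close>-tuples divided by the
  number \<open>\<gamma>\<^bsub>q\<^esub>(m)\<close> of bases of an \<open>m\<close>-dimensional space.  By Nakayama's lemma a tuple generates \<open>V\<close>
  iff it is independent modulo \<open>\<phi>(T) V\<close> for every prime factor \<open>\<phi>\<close> of \<open>g\<close>.  Such tuples are
  counted by extending them one vector at a time: after \<open>k\<close> vectors the new one has to avoid, for each
  \<open>\<phi>\<close>, a submodule of index \<open>q\<^bsup>(m-k) deg \<phi>\<^esup>\<close>; these submodules are pairwise comaximal, so the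
  conditions are independent.\<close>

section \<open>Polynomials and counting\<close>

text \<open>Sizes take the place of dimensions and quotients. A submodule \<open>gen Y ws\<close>
  containing Y stands for the submodule of V/Y spanned by \<open>ws\<close>, and independence modulo
  Y means that its size reaches the largest possible value. Equality of finite sizes then does the
  work of dimension theory: m vectors are independent iff they span, and a surjective sum map is
  bijective. The latter is why generating suffices for splitting: as g(T) = 0 and deg g = d, a
  generating W gives V as the sum of the T^i W with i < d, and |W|^d \<le> q^(m d) = |V| leaves no
  room for two decompositions of one vector. Each of the m extension steps contributes |V| = q^(m
  d), hence the power q^(m^2 d), and the step after k vectors contributes the factors with j = m -
  k. About T the count uses only that |V| = q^(m d), that g(T) = 0 and that some m vectors generate
  V, so it is the same for all T. Since \<open>sigma\<close> is a definite description, an operator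
  with these invariant factors must also be exhibited, which needs an explicit Smith form.\<close>

definition polys_below :: "nat \<Rightarrow> 'a::zero poly set" where
  "polys_below n = {p. \<forall>i\<ge>n. coeff p i = 0}"

lemma polys_below_Suc:
  "polys_below (Suc n) = (\<lambda>(a, p). pCons a p) ` (UNIV \<times> polys_below n)"
proof (intro equalityI subsetI)
  fix p :: "'a poly" assume p: "p \<in> polys_below (Suc n)"
  obtain a r where ar: "p = pCons a r" by (cases p) auto
  have "r \<in> polys_below n"
    using p unfolding ar polys_below_def by (auto simp: coeff_pCons dest: spec[of _ "Suc _"])
  then show "p \<in> (\<lambda>(a, p). pCons a p) ` (UNIV \<times> polys_below n)" using ar by force
next
  fix p :: "'a poly" assume "p \<in> (\<lambda>(a, p). pCons a p) ` (UNIV \<times> polys_below n)"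
  then show "p \<in> polys_below (Suc n)"
    by (auto simp: polys_below_def coeff_pCons split: nat.splits)
qed

lemma finite_card_polys_below:
  "finite (polys_below n :: 'a::{finite,zero} poly set) \<and>
   card (polys_below n :: 'a poly set) = CARD('a) ^ n"
proof (induction n)
  case 0
  \<comment> \<open>The bound is put on coefficients and not on \<open>degree\<close>, so the zero
    polynomial remains at n = 0.\<close>
  have "polys_below 0 = {0 :: 'a poly}" by (auto simp: polys_below_def poly_eq_iff)
  then show ?case by simp
next
  case (Suc n)
  have "inj_on (\<lambda>(a, p). pCons a p) (UNIV \<times> polys_below n :: ('a \<times> 'a poly) set)"
    by (auto intro!: inj_onI)
  with Suc show ?case by (simp add: polys_below_Suc card_image card_cartesian_product)
qed

lemma mod_in_polys_below: "p mod f \<in> polys_below (degree f)" if "f \<noteq> 0" for p f :: "'a::field poly"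
  using degree_mod_less[OF that, of p] by (auto simp: polys_below_def coeff_eq_0)

lemma diff_in_polys_below:
  "p - r \<in> polys_below n" if "p \<in> polys_below n" "r \<in> polys_below n" for p r :: "'a::ab_group_add poly"
  using that by (auto simp: polys_below_def)

lemma polys_below_dvd_eq_0:
  "c = 0" if "c \<in> polys_below (degree f)" "f dvd c" for c f :: "'a::field poly"
proof (rule ccontr)
  assume c: "c \<noteq> 0"
  have "degree f \<le> degree c" using dvd_imp_degree_le[OF that(2) c] .
  then have "coeff c (degree c) = 0" using that(1) by (auto simp: polys_below_def)
  with c show False by simp
qed

lemma irreducible_degree_pos: "0 < degree f" if "irreducible f" for f :: "'a::field poly"
  using that by (metis irreducible_def is_unit_iff_degree gr0I)

text \<open>A nonzero element r of least degree in the ideal generated by f and p divides both, by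
  division with remainder. As f is irreducible, r is a unit or f divides r, and the latter would
  give \<open>f dvd p\<close>.\<close>

lemma irreducible_bezout:
  fixes f p :: "'a::field poly"
  assumes f: "irreducible f" and p: "\<not> f dvd p"
  shows "\<exists>a b. a * f + b * p = 1"
proof -
  define I where "I = {r. \<exists>a b. r = a * f + b * p}"
  have f0: "f \<noteq> 0" using f by (auto simp: irreducible_def)
  have fI: "f \<in> I" unfolding I_def using add_0_right[of f] by (metis (mono_tags, lifting) mem_Collect_eq mult_1 mult_zero_left)
  have pI: "p \<in> I" unfolding I_def using add_0_left[of p] by (metis (mono_tags, lifting) mem_Collect_eq mult_1 mult_zero_left)
  obtain r where r: "r \<in> I" "r \<noteq> 0"
    and min: "\<And>s. s \<in> I \<Longrightarrow> s \<noteq> 0 \<Longrightarrow> degree r \<le> degree s"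
    using ex_has_least_nat[of "\<lambda>r. r \<in> I \<and> r \<noteq> 0" f degree] fI f0 by blast
  have dvd: "r dvd s" if s: "s \<in> I" for s
  proof (rule ccontr)
    assume nd: "\<not> r dvd s"
    obtain a b a' b' where "r = a * f + b * p" "s = a' * f + b' * p"
      using r(1) s unfolding I_def by blast
    then have "s mod r = (a' - (s div r) * a) * f + (b' - (s div r) * b) * p"
      by (simp add: minus_div_mult_eq_mod[symmetric] algebra_simps)
    then have "s mod r \<in> I" unfolding I_def by blast
    moreover have "s mod r \<noteq> 0" using nd by (simp add: dvd_eq_mod_eq_0)
    moreover have "degree (s mod r) < degree r"
      using degree_mod_less[OF r(2), of s] calculation(2) by auto
    ultimately show False using min by fastforce
  qed
  have "r dvd f" "r dvd p" using dvd fI pI by auto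
  then have "is_unit r" using f p irreducibleD' by (metis dvd_trans)
  then obtain u where u: "1 = r * u" by (rule dvdE)
  obtain a b where "r = a * f + b * p" using r(1) unfolding I_def by blast
  then have "(u * a) * f + (u * b) * p = 1" using u by (simp add: algebra_simps)
  then show ?thesis by blast
qed

text \<open>Lists grow at the front. As tails of admissible lists are admissible, they form a tree
  in which every node at depth i has c i children. The numbers c i are real so that differences and
  proportions can be inserted directly.\<close>

lemma card_lists_by_extension:
  fixes P :: "'b list \<Rightarrow> bool" and c :: "nat \<Rightarrow> real"
  assumes nil: "P []" and tl: "\<And>w ws. P (w # ws) \<Longrightarrow> P ws"
    and fin: "\<And>ws. finite {w. P (w # ws)}"
    and ext: "\<And>ws. P ws \<Longrightarrow> length ws < k \<Longrightarrow> real (card {w. P (w # ws)}) = c (length ws)"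
  shows "finite {ws. length ws = k \<and> P ws} \<and> real (card {ws. length ws = k \<and> P ws}) = (\<Prod>i<k. c i)"
  using ext
proof (induction k)
  case 0
  have "{ws. length ws = 0 \<and> P ws} = {[]}" using nil by auto
  then show ?case by simp
next
  case (Suc k)
  let ?A = "{ws. length ws = k \<and> P ws}"
  have IH: "finite ?A" "real (card ?A) = (\<Prod>i<k. c i)" using Suc by auto
  have eq: "{ws. length ws = Suc k \<and> P ws} = (\<lambda>(ws, w). w # ws) ` (SIGMA ws:?A. {w. P (w # ws)})"
    using tl by (force simp: length_Suc_conv)
  have inj: "inj_on (\<lambda>(ws, w). w # ws) (SIGMA ws:?A. {w. P (w # ws)})" by (auto intro!: inj_onI)
  have "real (card {ws. length ws = Suc k \<and> P ws}) = (\<Sum>ws\<in>?A. real (card {w. P (w # ws)}))"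
    unfolding eq card_image[OF inj] using IH fin by (simp add: card_SigmaI)
  also have "\<dots> = (\<Sum>ws\<in>?A. c k)" using Suc.prems by (intro sum.cong) auto
  also have "\<dots> = (\<Prod>i<Suc k. c i)" using IH by simp
  finally show ?case using IH fin unfolding eq by (simp add: finite_imageI)
qed

text \<open>A is stable under translation by K, and every v is congruent modulo N to an element of
  K. Hence all cosets of N meet A in equally many points, and counting the pairs (v, a) with a - v
  in N in two ways gives the formula: membership in A and membership in N are independent
  events.\<close>

lemma card_inter_comaximal:
  fixes N K A :: "'v::ab_group_add set"
  assumes fin: "finite (UNIV :: 'v set)"
    and N0: "0 \<in> N" and Ndiff: "\<And>x y. x \<in> N \<Longrightarrow> y \<in> N \<Longrightarrow> x - y \<in> N"
    and sum: "\<And>v. \<exists>x\<in>N. \<exists>k\<in>K. v = x + k"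
    and A: "\<And>a k. k \<in> K \<Longrightarrow> a \<in> A \<longleftrightarrow> a + k \<in> A"
  shows "CARD('v) * card (A \<inter> N) = card A * card N"
proof -
  note [simp] = finite_subset[OF subset_UNIV fin]
  have Nadd: "x + y \<in> N" if "x \<in> N" "y \<in> N" for x y
    using Ndiff[OF that(1) Ndiff[OF N0 that(2)]] by simp
  have coset: "card {a\<in>A. a - v \<in> N} = card (A \<inter> N)" for v
  proof -
    obtain x k where xk: "x \<in> N" "k \<in> K" "v = x + k" using sum by blast
    have "{a\<in>A. a - v \<in> N} = (\<lambda>a. a + k) ` (A \<inter> N)"
    proof (intro equalityI subsetI)
      fix a assume a: "a \<in> {a\<in>A. a - v \<in> N}"
      have "a - k \<in> N" using Nadd[of "a - v" x] a xk by simp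
      moreover have "a - k \<in> A" using A[OF xk(2), of "a - k"] a by simp
      ultimately show "a \<in> (\<lambda>a. a + k) ` (A \<inter> N)" by (intro image_eqI[of _ _ "a - k"]) auto
    next
      fix a assume "a \<in> (\<lambda>a. a + k) ` (A \<inter> N)"
      then obtain b where "b \<in> A" "b \<in> N" "a = b + k" by auto
      then show "a \<in> {a\<in>A. a - v \<in> N}" using A[OF xk(2)] Ndiff[of b x] xk by auto
    qed
    then show ?thesis by (simp add: card_image inj_on_def)
  qed
  have fibre: "card {v. a - v \<in> N} = card N" for a
  proof -
    have "{v. a - v \<in> N} = (\<lambda>x. a - x) ` N"
      by (auto intro!: image_eqI[of _ _ "a - _"])
    then show ?thesis by (simp add: card_image inj_on_def)
  qed
  have "CARD('v) * card (A \<inter> N) = (\<Sum>v\<in>UNIV. card {a\<in>A. a - v \<in> N})" by (simp add: coset)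
  also have "\<dots> = (\<Sum>a\<in>A. card {v\<in>UNIV. a - v \<in> N})"
    by (rule sum_multicount_gen[symmetric]) auto
  also have "\<dots> = card A * card N" by (simp add: fibre)
  finally show ?thesis .
qed

section \<open>Submodules for the action of an operator\<close>

locale operator_space = vector_space scale
  for scale :: "'a::{field,finite} \<Rightarrow> 'v::ab_group_add \<Rightarrow> 'v" +
  fixes T :: "'v \<Rightarrow> 'v"
  assumes linear_T: "Vector_Spaces.linear scale scale T"
begin

lemma T_add: "T (x + y) = T x + T y"
  and T_scale: "T (scale a x) = scale a (T x)"
  and T_0: "T 0 = 0"
proof -
  interpret Vector_Spaces.linear scale scale T by (rule linear_T)
  show "T (x + y) = T x + T y" "T (scale a x) = scale a (T x)" "T 0 = 0"
    by (auto simp: add scale)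
qed

text \<open>p(T) v by Horner's scheme: the F[x]-module structure on V in which x acts as T.\<close>

definition pact :: "'a poly \<Rightarrow> 'v \<Rightarrow> 'v" where
  "pact p v = fold_coeffs (\<lambda>a u. scale a v + T u) p 0"

lemma pact_0 [simp]: "pact 0 v = 0"
  by (simp add: pact_def)

lemma pact_pCons [simp]: "pact (pCons a p) v = scale a v + T (pact p v)"
  by (cases "p = 0 \<and> a = 0") (auto simp: pact_def T_0)

lemma pact_1 [simp]: "pact 1 v = v"
  by (simp add: one_pCons T_0)

lemma pact_zero_right [simp]: "pact p 0 = 0"
  by (induction p) (auto simp: T_0)

lemma pact_add: "pact (p + r) v = pact p v + pact r v"
  by (induction p r rule: poly_induct2) (auto simp: scale_left_distrib T_add T_0 algebra_simps)

lemma pact_add_right: "pact p (v + w) = pact p v + pact p w"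
  by (induction p) (auto simp: scale_right_distrib T_add T_0 algebra_simps)

lemma pact_T: "pact p (T v) = T (pact p v)"
  by (induction p) (auto simp: T_add T_scale T_0)

lemma pact_scale: "pact p (scale a v) = scale a (pact p v)"
  by (induction p) (auto simp: scale_right_distrib scale_left_commute T_scale T_0)

lemma pact_smult: "pact (Polynomial.smult a p) v = scale a (pact p v)"
  by (induction p) (auto simp: scale_right_distrib T_scale T_0)

lemma pact_mult: "pact (p * r) v = pact p (pact r v)"
  by (induction p) (auto simp: pact_add pact_smult pact_T pact_scale)

lemma pact_diff: "pact (p - r) v = pact p v - pact r v"
  using pact_add[of "p - r" r v] by simp

lemma pact_sum: "pact (sum f A) v = (\<Sum>i\<in>A. pact (f i) v)"
  by (induction A rule: infinite_finite_induct) (auto simp: pact_add)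

lemma pact_sum_right: "pact p (sum f A) = (\<Sum>i\<in>A. pact p (f i))"
  by (induction A rule: infinite_finite_induct) (auto simp: pact_add_right)

definition submod :: "'v set \<Rightarrow> bool" where
  "submod U \<longleftrightarrow> subspace U \<and> T ` U \<subseteq> U"

lemma submodI:
  assumes "0 \<in> U" "\<And>x y. x \<in> U \<Longrightarrow> y \<in> U \<Longrightarrow> x + y \<in> U" "\<And>p x. x \<in> U \<Longrightarrow> pact p x \<in> U"
  shows "submod U"
  using assms(1,2) assms(3)[of _ "[:_:]"] assms(3)[of _ "[:0, 1:]"]
  by (auto simp: submod_def subspace_def T_0)

lemma submod_zero: "submod U \<Longrightarrow> 0 \<in> U"
  and submod_add: "submod U \<Longrightarrow> x \<in> U \<Longrightarrow> y \<in> U \<Longrightarrow> x + y \<in> U"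
  and submod_diff: "submod U \<Longrightarrow> x \<in> U \<Longrightarrow> y \<in> U \<Longrightarrow> x - y \<in> U"
  by (auto simp: submod_def subspace_0 subspace_add subspace_diff)

lemma submod_pact: "submod U \<Longrightarrow> x \<in> U \<Longrightarrow> pact p x \<in> U"
  by (induction p) (auto simp: submod_def subspace_0 subspace_add subspace_scale)

lemma submod_range_pact: "submod (range (pact f))"
proof (rule submodI)
  show "0 \<in> range (pact f)" by (rule range_eqI[of _ _ 0]) simp
next
  fix x y assume "x \<in> range (pact f)" "y \<in> range (pact f)"
  then show "x + y \<in> range (pact f)" by (auto simp flip: pact_add_right)
next
  fix p x assume "x \<in> range (pact f)"
  then obtain v where "x = pact f v" by auto
  then have "pact p x = pact f (pact p v)" by (simp add: mult.commute flip: pact_mult)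
  then show "pact p x \<in> range (pact f)" by simp
qed

lemma submod_singleton: "submod {0}"
  by (auto simp: submod_def T_0)

text \<open>The base Y replaces the passage to a quotient: for a submodule Y this is the preimage in
  V of the submodule of V/Y generated by \<open>ws\<close>.\<close>

primrec gen :: "'v set \<Rightarrow> 'v list \<Rightarrow> 'v set" where
  "gen Y [] = Y"
| "gen Y (w # ws) = (\<lambda>(c, y). pact c w + y) ` (UNIV \<times> gen Y ws)"

text \<open>If an irreducible f maps V into the submodule Y, then V/Y is a vector space over the
  field F[x]/(f), and this is linear independence there.\<close>

primrec indep :: "'v set \<Rightarrow> 'v list \<Rightarrow> bool" where
  "indep Y [] \<longleftrightarrow> True"
| "indep Y (w # ws) \<longleftrightarrow> indep Y ws \<and> w \<notin> gen Y ws"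

lemma submod_gen: "submod (gen Y ws)" if Y: "submod Y"
proof (induction ws)
  case Nil
  then show ?case using Y by simp
next
  case (Cons w ws)
  show ?case
  proof (rule submodI)
    show "0 \<in> gen Y (w # ws)" using submod_zero[OF Cons] by (force intro: image_eqI[of _ _ "(0, 0)"])
  next
    fix x y assume "x \<in> gen Y (w # ws)" "y \<in> gen Y (w # ws)"
    then obtain c x' e y' where *: "x = pact c w + x'" "y = pact e w + y'" "x' \<in> gen Y ws" "y' \<in> gen Y ws"
      by auto
    then have "x + y = pact (c + e) w + (x' + y')" by (simp add: pact_add)
    moreover have "x' + y' \<in> gen Y ws" using Cons * submod_add by blast
    ultimately show "x + y \<in> gen Y (w # ws)" by (force intro: image_eqI[of _ _ "(c + e, x' + y')"])
  next
    fix p x assume "x \<in> gen Y (w # ws)"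
    then obtain c x' where *: "x = pact c w + x'" "x' \<in> gen Y ws" by auto
    then have "pact p x = pact (p * c) w + pact p x'" by (simp add: pact_add_right pact_mult)
    moreover have "pact p x' \<in> gen Y ws" using Cons * submod_pact by blast
    ultimately show "pact p x \<in> gen Y (w # ws)" by (force intro: image_eqI[of _ _ "(p * c, pact p x')"])
  qed
qed

lemma gen_tail_subset: "gen Y ws \<subseteq> gen Y (w # ws)"
  by (force intro: image_eqI[of _ _ "(0, _)"])

lemma base_subset_gen: "Y \<subseteq> gen Y ws"
  by (induction ws) (use gen_tail_subset in fastforce)+

lemma set_subset_gen: "set ws \<subseteq> gen Y ws" if Y: "submod Y"
proof (induction ws)
  case (Cons w ws)
  have "w \<in> gen Y (w # ws)"
    using submod_zero[OF submod_gen[OF Y], of ws] by (force intro: image_eqI[of _ _ "(1, 0)"])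
  with Cons show ?case using gen_tail_subset[of Y ws w] by auto
qed simp

lemma gen_least: "gen Y ws \<subseteq> Z" if "submod Z" "Y \<subseteq> Z" "set ws \<subseteq> Z"
  using that(3)
proof (induction ws)
  case (Cons w ws)
  then show ?case by (auto intro!: submod_add[OF that(1)] submod_pact[OF that(1)])
qed (use that in simp)

lemma gen_mono_base: "gen Y ws \<subseteq> gen Z ws" if "Y \<subseteq> Z"
  using that by (induction ws) auto

text \<open>Only the remainder of a coefficient modulo f matters, since multiples of f send w into
  \<open>gen Y ws\<close>.\<close>

lemma gen_Cons_polys_below:
  assumes Y: "submod Y" and f: "f \<noteq> 0" "pact f w \<in> gen Y ws"
  shows "gen Y (w # ws) = (\<lambda>(c, y). pact c w + y) ` (polys_below (degree f) \<times> gen Y ws)"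
proof (intro equalityI subsetI)
  fix x assume "x \<in> gen Y (w # ws)"
  then obtain c y where x: "x = pact c w + y" "y \<in> gen Y ws" by auto
  note G = submod_gen[OF Y, of ws]
  have "pact c w = pact (c mod f) w + pact (c div f) (pact f w)"
    by (simp flip: pact_add pact_mult)
  then have "x = pact (c mod f) w + (pact (c div f) (pact f w) + y)" using x by simp
  moreover have "pact (c div f) (pact f w) + y \<in> gen Y ws"
    using submod_add[OF G submod_pact[OF G f(2)] x(2)] .
  ultimately show "x \<in> (\<lambda>(c, y). pact c w + y) ` (polys_below (degree f) \<times> gen Y ws)"
    using mod_in_polys_below[OF f(1)] by (force intro: image_eqI[of _ _ "(c mod f, _)"])
qed auto

lemma gen_card_le:
  assumes Y: "submod Y" "finite Y" and f: "f \<noteq> 0" "\<And>w. w \<in> set ws \<Longrightarrow> pact f w \<in> Y"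
  shows "finite (gen Y ws) \<and> card (gen Y ws) \<le> CARD('a) ^ (length ws * degree f) * card Y"
  using f(2)
proof (induction ws)
  case Nil
  then show ?case using Y by simp
next
  case (Cons w ws)
  have fw: "pact f w \<in> gen Y ws" using Cons.prems base_subset_gen[of Y ws] by auto
  note eq = gen_Cons_polys_below[OF Y(1) f(1) fw]
  have IH: "finite (gen Y ws)" "card (gen Y ws) \<le> CARD('a) ^ (length ws * degree f) * card Y"
    using Cons by auto
  note fin = finite_card_polys_below[where 'a = 'a and n = "degree f"]
  have "card (gen Y (w # ws)) \<le> card (polys_below (degree f) \<times> gen Y ws :: ('a poly \<times> 'v) set)"
    unfolding eq by (rule card_image_le) (use IH fin in auto)
  also have "\<dots> = CARD('a) ^ degree f * card (gen Y ws)"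
    using fin by (simp add: card_cartesian_product)
  also have "\<dots> \<le> CARD('a) ^ degree f * (CARD('a) ^ (length ws * degree f) * card Y)"
    using IH by simp
  finally show ?case using IH fin unfolding eq by (simp add: power_add algebra_simps)
qed

text \<open>The polynomials sending w into U form an ideal that contains f but not 1, so for
  irreducible f it is the ideal of f.\<close>

lemma pact_mem_irreducible:
  assumes U: "submod U" and f: "irreducible f" "pact f w \<in> U" and c: "pact c w \<in> U" and w: "w \<notin> U"
  shows "f dvd c"
proof (rule ccontr)
  assume "\<not> f dvd c"
  then obtain a b where "a * f + b * c = 1" using irreducible_bezout f(1) by blast
  then have "w = pact (a * f + b * c) w" by simp
  also have "\<dots> = pact a (pact f w) + pact b (pact c w)" by (simp add: pact_add pact_mult)
  also have "\<dots> \<in> U" by (intro submod_add submod_pact U f c)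
  finally show False using w by simp
qed

text \<open>Two remainders modulo f that send w into the same coset of \<open>gen Y ws\<close>
  differ by a multiple of f and hence coincide.\<close>

lemma card_gen_Cons_irreducible:
  assumes Y: "submod Y" and f: "irreducible f" "pact f w \<in> gen Y ws" and w: "w \<notin> gen Y ws"
  shows "card (gen Y (w # ws)) = CARD('a) ^ degree f * card (gen Y ws)"
proof -
  note G = submod_gen[OF Y, of ws]
  have f0: "f \<noteq> 0" using f by (auto simp: irreducible_def)
  have "inj_on (\<lambda>(c, y). pact c w + y) (polys_below (degree f) \<times> gen Y ws)"
  proof (rule inj_onI, clarsimp)
    fix c e y z
    assume ce: "c \<in> polys_below (degree f)" "e \<in> polys_below (degree f)"
      and yz: "y \<in> gen Y ws" "z \<in> gen Y ws" and eq: "pact c w + y = pact e w + z"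
    have "pact (c - e) w = z - y" using eq by (simp add: pact_diff algebra_simps)
    then have "pact (c - e) w \<in> gen Y ws" using submod_diff[OF G] yz by simp
    then have "f dvd c - e" using pact_mem_irreducible[OF G f _ w] by simp
    then have "c - e = 0" using polys_below_dvd_eq_0 diff_in_polys_below ce by blast
    then show "c = e \<and> y = z" using eq by simp
  qed
  then show ?thesis unfolding gen_Cons_polys_below[OF Y f0 f(2)]
    by (simp add: card_image card_cartesian_product finite_card_polys_below)
qed

text \<open>A vector inside the previous submodule leaves the size unchanged, one outside multiplies
  it by q^(deg f). As deg f > 0, a single redundant vector keeps the size below the bound of
  \<open>gen_card_le\<close>.\<close>

lemma indep_iff_card_gen:
  assumes Y: "submod Y" "finite Y" and f: "irreducible f" "\<And>w. w \<in> set ws \<Longrightarrow> pact f w \<in> Y"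
  shows "indep Y ws \<longleftrightarrow> card (gen Y ws) = CARD('a) ^ (length ws * degree f) * card Y"
  using f(2)
proof (induction ws)
  case (Cons w ws)
  have f0: "f \<noteq> 0" using f by (auto simp: irreducible_def)
  have fw: "pact f w \<in> gen Y ws" using Cons.prems base_subset_gen[of Y ws] by auto
  have "card {0, 1 :: 'a} \<le> CARD('a)" by (rule card_mono) auto
  then have q: "1 < CARD('a)" by simp
  have cY: "0 < card Y" using Y submod_zero[of Y] by (auto simp: card_gt_0_iff)
  have le: "card (gen Y ws) \<le> CARD('a) ^ (length ws * degree f) * card Y"
    using gen_card_le[OF Y f0] Cons.prems by auto
  show ?case
  proof (cases "w \<in> gen Y ws")
    case True
    have "gen Y (w # ws) \<subseteq> gen Y ws"
      using base_subset_gen set_subset_gen[OF Y(1)] True by (intro gen_least submod_gen Y) auto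
    then have "gen Y (w # ws) = gen Y ws" using gen_tail_subset by blast
    moreover have "CARD('a) ^ (length ws * degree f) < CARD('a) ^ (length (w # ws) * degree f)"
      using irreducible_degree_pos[OF f(1)] q by (intro power_strict_increasing) auto
    then have "CARD('a) ^ (length ws * degree f) * card Y < CARD('a) ^ (length (w # ws) * degree f) * card Y"
      using cY by simp
    ultimately show ?thesis using le True by (auto simp del: gen.simps)
  next
    case False
    then show ?thesis using card_gen_Cons_irreducible[OF Y(1) f(1) fw False] Cons
      by (simp add: power_add ac_simps del: gen.simps)
  qed
qed simp

end

section \<open>Comaximality of distinct primes and independence of the avoidance conditions\<close>

lemma dvd_prod_powers:
  fixes k :: "'b::comm_semiring_1 \<Rightarrow> nat"
  assumes "finite S" "f \<in> S" "0 < k f"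
  shows "f dvd (\<Prod>f\<in>S. f ^ k f)"
proof -
  have "f dvd f ^ k f" using assms(3) by (simp add: dvd_power)
  also have "\<dots> dvd (\<Prod>f\<in>S. f ^ k f)" using assms(1,2) by (rule dvd_prodI)
  finally show ?thesis .
qed

lemma monic_irreducible_not_dvd:
  "\<not> f dvd p" if "irreducible f" "irreducible p" "lead_coeff f = 1" "lead_coeff p = 1" "f \<noteq> p"
  for f p :: "'a::field poly"
proof
  assume "f dvd p"
  then have "p dvd f \<or> is_unit f" using irreducibleD' that(2) by blast
  then have "p dvd f" using that(1) irreducible_not_unit by blast
  with \<open>f dvd p\<close> have "f = p" using poly_dvd_antisym that(3,4) by metis
  with that(5) show False ..
qed

text \<open>Multiply the Bezout identity for S by the one for p: every term contains f except the
  one with p times the product of S.\<close>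

lemma irreducible_comaximal_prod:
  fixes f :: "'a::field poly"
  assumes "finite S" and f: "irreducible f" "lead_coeff f = 1" "f \<notin> S"
    and S: "\<And>p. p \<in> S \<Longrightarrow> irreducible p" "\<And>p. p \<in> S \<Longrightarrow> lead_coeff p = 1"
  shows "\<exists>a b. a * f + b * \<Prod>S = 1"
  using assms(1) f(3) S
proof (induction S)
  case empty
  have "0 * f + 1 * \<Prod>{} = 1" by simp
  then show ?case by blast
next
  case (insert p S)
  obtain a b where ab: "a * f + b * \<Prod>S = 1" using insert by auto
  have "\<not> f dvd p" using monic_irreducible_not_dvd[of f p] f insert by auto
  then obtain a' b' where ab': "a' * f + b' * p = 1" using irreducible_bezout f(1) by blast
  have "(a * a' * f + a * b' * p + b * \<Prod>S * a') * f + (b * b') * (p * \<Prod>S)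
      = (a * f + b * \<Prod>S) * (a' * f + b' * p)"
    by (simp add: algebra_simps)
  then have "(a * a' * f + a * b' * p + b * \<Prod>S * a') * f + (b * b') * \<Prod>(insert p S) = 1"
    using ab ab' insert by simp
  then show ?case by blast
qed

context operator_space
begin

text \<open>Here r f is the proportion of N f in V. Avoiding the other submodules is independent of
  lying in N f, so inserting f multiplies the proportion of admissible vectors by 1 - r f.\<close>

lemma card_avoiding:
  assumes fin: "finite (UNIV :: 'v set)" and "finite S"
    and S: "\<And>f. f \<in> S \<Longrightarrow> irreducible f" "\<And>f. f \<in> S \<Longrightarrow> lead_coeff f = 1"
    and N: "\<And>f. f \<in> S \<Longrightarrow> submod (N f)" "\<And>f. f \<in> S \<Longrightarrow> range (pact f) \<subseteq> N f"
    and r: "\<And>f. f \<in> S \<Longrightarrow> real (card (N f)) = real CARD('v) * r f"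
  shows "real (card {w. \<forall>f\<in>S. w \<notin> N f}) = real CARD('v) * (\<Prod>f\<in>S. 1 - r f)"
  using assms(2-)
proof (induction S)
  case (insert f S)
  note [simp] = finite_subset[OF subset_UNIV fin]
  let ?A = "{w. \<forall>f\<in>S. w \<notin> N f}"
  have Nf: "submod (N f)" using insert by auto
  have "CARD('v) * card (?A \<inter> N f) = card ?A * card (N f)"
  \<comment> \<open>With p ranging over S, this K lies in every p(T) V, hence in every N p, so
    translation by it preserves \<open>?A\<close>. Bezout makes it comaximal with f(T) V, hence with
    N f.\<close>
  proof (rule card_inter_comaximal[where K = "range (pact (\<Prod>S))"])
    show "finite (UNIV :: 'v set)" by (rule fin)
    show "0 \<in> N f" using submod_zero[OF Nf] .
    show "x - y \<in> N f" if "x \<in> N f" "y \<in> N f" for x y using submod_diff[OF Nf that] .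
    show "\<exists>x\<in>N f. \<exists>k\<in>range (pact (\<Prod>S)). v = x + k" for v
    proof -
      obtain a b where "a * f + b * \<Prod>S = 1"
        using irreducible_comaximal_prod[of S f] insert by auto
      then have "v = pact (f * a + \<Prod>S * b) v" by (simp add: mult.commute)
      also have "\<dots> = pact f (pact a v) + pact (\<Prod>S) (pact b v)" by (simp add: pact_add pact_mult)
      finally show ?thesis using insert.prems(4)[of f] by blast
    qed
    show "a \<in> ?A \<longleftrightarrow> a + k \<in> ?A" if k: "k \<in> range (pact (\<Prod>S))" for a k
    proof -
      have kN: "k \<in> N p" if p: "p \<in> S" for p
      proof -
        have "\<Prod>S = p * \<Prod>(S - {p})" using insert.hyps p by (simp add: prod.remove)
        then have "k \<in> range (pact p)" using k by (auto simp: pact_mult)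
        then show ?thesis using insert.prems(4) p by auto
      qed
      have "a \<in> N p \<longleftrightarrow> a + k \<in> N p" if p: "p \<in> S" for p
        using submod_add[of "N p" a k] submod_diff[of "N p" "a + k" k] kN[OF p] insert.prems(3)[of p] p
        by auto
      then show ?thesis by auto
    qed
  qed
  then have "real CARD('v) * real (card (?A \<inter> N f)) = real (card ?A) * real (card (N f))"
    by (simp only: flip: of_nat_mult)
  also have "\<dots> = real CARD('v) * (real (card ?A) * r f)"
    by (simp only: insert.prems(5)[OF insertI1] ac_simps)
  finally have inter: "real (card (?A \<inter> N f)) = real (card ?A) * r f"
    by (rule mult_left_cancel[THEN iffD1, rotated]) (use fin in simp)
  have "{w. \<forall>f\<in>insert f S. w \<notin> N f} = ?A - (?A \<inter> N f)" by auto
  then have "card {w. \<forall>f\<in>insert f S. w \<notin> N f} = card ?A - card (?A \<inter> N f)"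
    by (simp add: card_Diff_subset)
  then have "real (card {w. \<forall>f\<in>insert f S. w \<notin> N f}) = real (card ?A) - real (card (?A \<inter> N f))"
    by (simp add: of_nat_diff card_mono)
  also have "\<dots> = real (card ?A) * (1 - r f)" by (simp add: inter algebra_simps)
  finally show ?case using insert by (simp add: algebra_simps)
qed simp

text \<open>f(T) is a module endomorphism, because polynomials in T commute.\<close>

lemma pact_image_gen: "pact f ` gen Y ws = gen (pact f ` Y) (map (pact f) ws)"
proof (induction ws)
  case (Cons w ws)
  have eq: "pact f (pact c w + y) = pact c (pact f w) + pact f y" for c y
    by (simp add: pact_add_right mult.commute flip: pact_mult)
  show ?case
  proof (intro equalityI subsetI)
    fix x assume "x \<in> pact f ` gen Y (w # ws)"
    then obtain c y where y: "y \<in> gen Y ws" "x = pact c (pact f w) + pact f y" by (auto simp: eq)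
    then have "pact f y \<in> gen (pact f ` Y) (map (pact f) ws)" by (simp flip: Cons)
    then show "x \<in> gen (pact f ` Y) (map (pact f) (w # ws))" using y by auto
  next
    fix x assume "x \<in> gen (pact f ` Y) (map (pact f) (w # ws))"
    then obtain c z where z: "z \<in> gen (pact f ` Y) (map (pact f) ws)" "x = pact c (pact f w) + z" by auto
    then obtain y where y: "y \<in> gen Y ws" "z = pact f y" unfolding Cons[symmetric] by blast
    then have "x = pact f (pact c w + y)" using z by (simp add: eq)
    moreover have "pact c w + y \<in> gen Y (w # ws)" using y(1) by auto
    ultimately show "x \<in> pact f ` gen Y (w # ws)" by blast
  qed
qed simp

lemma gen_decompose: "v \<in> gen Y ws \<Longrightarrow> \<exists>x\<in>gen {0} ws. \<exists>y\<in>Y. v = x + y"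
proof (induction ws arbitrary: v)
  case (Cons w ws)
  obtain c u where v: "v = pact c w + u" "u \<in> gen Y ws" using Cons.prems by auto
  obtain x y where "x \<in> gen {0} ws" "y \<in> Y" "u = x + y" using Cons.IH[OF v(2)] by auto
  then show ?case using v by (intro bexI[of _ "pact c w + x"] bexI[of _ y]) (auto simp: add.assoc)
qed simp

lemma pact_monom: "pact (monom a n) v = scale a ((T ^^ n) v)"
  by (induction n) (auto simp: monom_0 monom_Suc T_scale T_0)

lemma pact_eq_sum: "pact p v = (\<Sum>i<n. scale (coeff p i) ((T ^^ i) v))" if "p \<in> polys_below n"
proof -
  have "p = (\<Sum>i<n. monom (coeff p i) i)"
    using that by (auto simp: poly_eq_iff coeff_sum polys_below_def not_less)
  then have "pact p v = pact (\<Sum>i<n. monom (coeff p i) i) v" by simp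
  also have "\<dots> = (\<Sum>i<n. scale (coeff p i) ((T ^^ i) v))" by (simp add: pact_sum pact_monom)
  finally show ?thesis .
qed

end

section \<open>Counting generating tuples and splitting subspaces\<close>

locale finite_vector_space = vector_space scale
  for scale :: "'a::{field,finite} \<Rightarrow> 'v::ab_group_add \<Rightarrow> 'v" +
  assumes finite_UNIV: "finite (UNIV :: 'v set)"
begin

text \<open>Plain linear algebra is the case T = 0: submodules are subspaces, \<open>gen {0}\<close>
  is the span, and the irreducible polynomial x of degree 1 kills everything, so
  \<open>indep {0}\<close> is linear independence. The sizes q^n of subspaces thus follow from the
  module lemmas.\<close>

sublocale zero_op: operator_space scale "\<lambda>_. 0"
proof unfold_locales
qed auto

lemma finite_subsets [simp]: "finite (A :: 'v set)"
  using finite_subset[OF subset_UNIV finite_UNIV] .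

lemma CARD_field_gt_1: "1 < CARD('a)"
proof -
  have "card {0, 1 :: 'a} \<le> CARD('a)" by (rule card_mono) auto
  then show ?thesis by simp
qed

lemma zero_op_gen: "zero_op.gen {0} ws = span (set ws)"
proof
  have "zero_op.submod (span (set ws))"
    unfolding zero_op.submod_def using span_zero by blast
  then show "zero_op.gen {0} ws \<subseteq> span (set ws)"
    by (rule zero_op.gen_least) (simp_all add: span_zero span_superset)
  have "subspace (zero_op.gen {0} ws)"
    using zero_op.submod_gen[OF zero_op.submod_singleton, of ws] unfolding zero_op.submod_def ..
  then show "span (set ws) \<subseteq> zero_op.gen {0} ws"
    by (intro span_minimal zero_op.set_subset_gen zero_op.submod_singleton)
qed

lemma irreducible_X: "irreducible ([:0, 1:] :: 'a poly)"
  by (rule irreducible_linear_field_poly) simp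

lemma card_span_le: "card (span (set ws)) \<le> CARD('a) ^ length ws"
  using zero_op.gen_card_le[OF zero_op.submod_singleton, of "[:0, 1:]" ws] by (simp add: zero_op_gen)

lemma zero_op_indep_iff: "zero_op.indep {0} ws \<longleftrightarrow> card (span (set ws)) = CARD('a) ^ length ws"
  using zero_op.indep_iff_card_gen[OF zero_op.submod_singleton _ irreducible_X, of ws]
  by (simp add: zero_op_gen)

lemma zero_op_indep_if_independent:
  "distinct ws \<Longrightarrow> independent (set ws) \<Longrightarrow> zero_op.indep {0} ws"
  by (induction ws) (auto simp: zero_op_gen independent_insert)

lemma card_subspace: "card W = CARD('a) ^ dim W" if W: "subspace W"
proof -
  obtain B where B: "B \<subseteq> W" "independent B" "W \<subseteq> span B" "card B = dim W"
    using basis_exists by blast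
  obtain bs where bs: "set bs = B" "distinct bs" using finite_distinct_list[of B] by auto
  have "W = span B" using B W span_minimal by blast
  then show ?thesis
    using zero_op_indep_if_independent[of bs] bs B by (simp add: zero_op_indep_iff distinct_card[symmetric])
qed

text \<open>For m vectors of W, spanning W and being independent both mean that the span has q^m
  elements. An independent list of length i in W has q^m - q^i extensions, which are the factors of
  \<open>gamma\<close>.\<close>

lemma card_spanning_lists:
  assumes W: "subspace W" "dim W = m"
  shows "real (card {ws. length ws = m \<and> span (set ws) = W}) = gamma CARD('a) m"
    and "finite {ws. length ws = m \<and> span (set ws) = W}"
proof -
  define P where "P ws \<longleftrightarrow> set ws \<subseteq> W \<and> zero_op.indep {0} ws" for ws
  have cW: "card W = CARD('a) ^ m" using card_subspace W by simp
  have eq: "{ws. length ws = m \<and> span (set ws) = W} = {ws. length ws = m \<and> P ws}"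
  proof (intro Collect_cong conj_cong refl iffI)
    fix ws :: "'v list" assume "length ws = m" "span (set ws) = W"
    then show "P ws" using span_superset cW by (auto simp: P_def zero_op_indep_iff)
  next
    fix ws assume l: "length ws = m" and P: "P ws"
    have "span (set ws) \<subseteq> W" using P W span_minimal by (auto simp: P_def)
    then show "span (set ws) = W"
      using P l cW by (intro card_subset_eq) (auto simp: P_def zero_op_indep_iff)
  qed
  have "finite {ws. length ws = m \<and> P ws} \<and>
      real (card {ws. length ws = m \<and> P ws}) = (\<Prod>i<m. real CARD('a) ^ m - real CARD('a) ^ i)"
  proof (rule card_lists_by_extension)
    fix ws assume P: "P ws"
    have sub: "span (set ws) \<subseteq> W" using P W span_minimal by (auto simp: P_def)
    have "{w. P (w # ws)} = W - span (set ws)" using P by (auto simp: P_def zero_op_gen)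
    moreover have "card (span (set ws)) = CARD('a) ^ length ws"
      using P by (simp add: P_def zero_op_indep_iff)
    ultimately show "real (card {w. P (w # ws)}) = real CARD('a) ^ m - real CARD('a) ^ length ws"
      using sub cW card_mono[OF _ sub] by (simp add: card_Diff_subset of_nat_diff)
  qed (auto simp: P_def)
  then show "real (card {ws. length ws = m \<and> span (set ws) = W}) = gamma CARD('a) m"
    and "finite {ws. length ws = m \<and> span (set ws) = W}"
    unfolding eq gamma_def by auto
qed

end

text \<open>The generators \<open>vs\<close> make the space a free module of rank \<open>length vs\<close> over \<open>F[x]/(g)\<close>.\<close>

locale homogeneous_operator = operator_space +
  fixes g :: "'a poly" and vs :: "'b list"
  assumes g_nonzero: "g \<noteq> 0"
    and pact_g [simp]: "pact g v = 0"
    and gen_vs: "gen {0} vs = UNIV"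
    and card_space: "CARD('b) = CARD('a) ^ (length vs * degree g)"
begin

sublocale finite_vector_space scale
proof unfold_locales
  \<comment> \<open>\<open>CARD\<close> is 0 for an infinite type, so positivity yields
    finiteness.\<close>
  have "0 < CARD('b)" unfolding card_space by simp
  then show "finite (UNIV :: 'b set)" by (simp add: card_gt_0_iff)
qed

text \<open>Two upper bounds meet; let m be \<open>length vs\<close>. The images of
  \<open>vs\<close> generate f(T) V and are killed by h, so its size is at most q^(m deg h). Modulo
  f(T) V the vectors \<open>vs\<close> generate V and are killed by f, so the index is at most q^(m
  deg f). The product of the bounds is |V|.\<close>

lemma card_range_pact:
  assumes fh: "f * h = g"
  shows "card (range (pact f)) = CARD('a) ^ (length vs * degree h)"
proof -
  have f0: "f \<noteq> 0" "h \<noteq> 0" and deg: "degree g = degree f + degree h"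
    using fh g_nonzero by (auto simp: degree_mult_eq)
  have "gen {0} (map (pact f) vs) = range (pact f)"
    using pact_image_gen[of f "{0}" vs] gen_vs by simp
  moreover have "pact h (pact f v) = 0" for v
    using fh by (simp add: mult.commute flip: pact_mult)
  ultimately have le: "card (range (pact f)) \<le> CARD('a) ^ (length vs * degree h)"
    using gen_card_le[OF submod_singleton _ f0(2), of "map (pact f) vs"] by auto
  have "gen (range (pact f)) vs = UNIV"
    using gen_mono_base[of "{0}" "range (pact f)" vs] submod_zero[OF submod_range_pact] gen_vs by auto
  then have "CARD('b) \<le> CARD('a) ^ (length vs * degree f) * card (range (pact f))"
    using gen_card_le[OF submod_range_pact _ f0(1), of f vs] by auto
  then have "CARD('a) ^ (length vs * degree h) \<le> card (range (pact f))"
    unfolding card_space deg by (simp add: power_add distrib_left)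
  with le show ?thesis by simp
qed

text \<open>Written as a proportion of V for \<open>card_avoiding\<close>. The index of f(T) V is
  q^(m deg f) with m = \<open>length vs\<close>, and each independent vector divides it by q^(deg
  f).\<close>

lemma card_gen_range_pact:
  assumes f: "irreducible f" "f dvd g" and ws: "length ws \<le> length vs" "indep (range (pact f)) ws"
  shows "real (card (gen (range (pact f)) ws)) =
    real CARD('b) * (1 / real CARD('a) ^ ((length vs - length ws) * degree f))"
proof -
  obtain h where h: "f * h = g" using f by (metis dvdE)
  then have deg: "degree g = degree f + degree h"
    using g_nonzero by (auto simp: degree_mult_eq)
  have "card (gen (range (pact f)) ws) = CARD('a) ^ (length ws * degree f) * card (range (pact f))"
    using indep_iff_card_gen[OF submod_range_pact _ f(1)] ws by auto
  also have "\<dots> = CARD('a) ^ (length ws * degree f + length vs * degree h)"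
    by (simp add: card_range_pact[OF h] power_add)
  finally have "card (gen (range (pact f)) ws) * CARD('a) ^ ((length vs - length ws) * degree f) =
      CARD('a) ^ (length ws * degree f + length vs * degree h + (length vs - length ws) * degree f)"
    by (simp add: power_add)
  also have "length ws * degree f + length vs * degree h + (length vs - length ws) * degree f = length vs * degree g"
    using ws(1) by (simp add: deg distrib_left diff_mult_distrib)
  also have "CARD('a) ^ (length vs * degree g) = CARD('b)" by (simp add: card_space)
  finally show ?thesis by (simp add: divide_simps flip: of_nat_mult of_nat_power)
qed

text \<open>V / f(T) V has dimension \<open>length vs\<close> over F[x]/(f), so for this many
  vectors independence and spanning agree.\<close>

lemma indep_iff_gen_eq_UNIV:
  assumes f: "irreducible f" "f dvd g" and ws: "length ws = length vs"
  shows "indep (range (pact f)) ws \<longleftrightarrow> gen (range (pact f)) ws = UNIV"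
proof
  assume "indep (range (pact f)) ws"
  then have "card (gen (range (pact f)) ws) = CARD('b)"
    using card_gen_range_pact[OF f, of ws] ws by simp
  then show "gen (range (pact f)) ws = UNIV" by (intro card_subset_eq) auto
next
  assume eq: "gen (range (pact f)) ws = UNIV"
  obtain h where h: "f * h = g" using f by (metis dvdE)
  then have deg: "degree g = degree f + degree h"
    using g_nonzero by (auto simp: degree_mult_eq)
  have "card (gen (range (pact f)) ws) = CARD('a) ^ (length ws * degree f) * card (range (pact f))"
    unfolding eq card_space card_range_pact[OF h] by (simp add: ws deg power_add distrib_left)
  then show "indep (range (pact f)) ws"
    using indep_iff_card_gen[OF submod_range_pact _ f(1)] by auto
qed

lemma gen_eq_UNIV_iff_indep:
  assumes S: "finite S" "\<And>f. f \<in> S \<Longrightarrow> irreducible f" "g = (\<Prod>f\<in>S. f ^ k f)" "\<And>f. f \<in> S \<Longrightarrow> 0 < k f"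
    and ws: "length ws = length vs"
  shows "gen {0} ws = UNIV \<longleftrightarrow> (\<forall>f\<in>S. indep (range (pact f)) ws)"
proof -
  have dvd: "f dvd g" if "f \<in> S" for f
    unfolding S(3) using S(1) that S(4)[OF that] by (rule dvd_prod_powers)
  \<comment> \<open>\<open>cov p\<close> says V = M + p(T) V with M = \<open>gen {0} ws\<close>.
    Inserting one such decomposition into another makes it multiplicative in p, and
    \<open>cov g\<close> is V = M because g(T) = 0. This is the Nakayama argument.\<close>
  define cov where "cov p \<longleftrightarrow> (\<forall>v. \<exists>x\<in>gen {0} ws. \<exists>u. v = x + pact p u)" for p
  note M = submod_gen[OF submod_singleton, of ws]
  have cov_1: "cov 1" unfolding cov_def using submod_zero[OF M] by (auto intro!: bexI[of _ 0])
  have cov_mult: "cov (p * r)" if p: "cov p" and r: "cov r" for p r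
    unfolding cov_def
  proof
    fix v
    obtain x u where x: "x \<in> gen {0} ws" "v = x + pact p u" using p unfolding cov_def by metis
    obtain y u' where y: "y \<in> gen {0} ws" "u = y + pact r u'" using r unfolding cov_def by metis
    have "v = (x + pact p y) + pact (p * r) u'"
      using x y by (simp add: pact_add_right pact_mult add.assoc)
    then show "\<exists>x\<in>gen {0} ws. \<exists>u. v = x + pact (p * r) u"
      using submod_add[OF M x(1) submod_pact[OF M y(1)]] by blast
  qed
  have cov_power: "cov (p ^ n)" if "cov p" for p n
    by (induction n) (auto simp: cov_1 cov_mult that)
  have "gen {0} ws = UNIV" if all: "\<forall>f\<in>S. gen (range (pact f)) ws = UNIV"
  proof -
    have cov_S: "cov f" if f: "f \<in> S" for f
      unfolding cov_def
    proof
      fix v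
      have "v \<in> gen (range (pact f)) ws" using all f by simp
      then show "\<exists>x\<in>gen {0} ws. \<exists>u. v = x + pact f u" using gen_decompose by fast
    qed
    have "cov (\<Prod>f\<in>S'. f ^ k f)" if "S' \<subseteq> S" for S'
      using finite_subset[OF that S(1)] that cov_S by (induction S' rule: finite_induct) (auto simp: cov_1 cov_mult cov_power)
    then have "cov g" using S(3) by simp
    then show ?thesis by (auto simp: cov_def)
  qed
  moreover have "gen (range (pact f)) ws = UNIV" if "gen {0} ws = UNIV" for f
    using gen_mono_base[of "{0}" "range (pact f)" ws] submod_zero[OF submod_range_pact] that by auto
  moreover have "indep (range (pact f)) ws \<longleftrightarrow> gen (range (pact f)) ws = UNIV" if "f \<in> S" for f
    using indep_iff_gen_eq_UNIV[OF S(2)[OF that] dvd[OF that] ws] .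
  ultimately show ?thesis by metis
qed

lemma card_generating_lists:
  assumes S: "finite S" "\<And>f. f \<in> S \<Longrightarrow> irreducible f" "g = (\<Prod>f\<in>S. f ^ k f)" "\<And>f. f \<in> S \<Longrightarrow> 0 < k f"
    and monic: "\<And>f. f \<in> S \<Longrightarrow> lead_coeff f = 1"
  shows "real (card {ws. length ws = length vs \<and> gen {0} ws = UNIV}) =
    (\<Prod>i<length vs. real CARD('b) * (\<Prod>f\<in>S. 1 - 1 / real CARD('a) ^ ((length vs - i) * degree f)))"
proof -
  define P where "P ws \<longleftrightarrow> (\<forall>f\<in>S. indep (range (pact f)) ws)" for ws
  have dvd: "f dvd g" if "f \<in> S" for f
    unfolding S(3) using S(1) that S(4)[OF that] by (rule dvd_prod_powers)
  have "{ws. length ws = length vs \<and> gen {0} ws = UNIV} = {ws. length ws = length vs \<and> P ws}"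
    using gen_eq_UNIV_iff_indep[OF S] by (auto simp: P_def)
  moreover have "finite {ws. length ws = length vs \<and> P ws} \<and>
     real (card {ws. length ws = length vs \<and> P ws}) =
     (\<Prod>i<length vs. real CARD('b) * (\<Prod>f\<in>S. 1 - 1 / real CARD('a) ^ ((length vs - i) * degree f)))"
  proof (rule card_lists_by_extension)
    fix ws assume P: "P ws" and len: "length ws < length vs"
    have "{w. P (w # ws)} = {w. \<forall>f\<in>S. w \<notin> gen (range (pact f)) ws}" using P by (auto simp: P_def)
    moreover have "real (card {w. \<forall>f\<in>S. w \<notin> gen (range (pact f)) ws}) =
      real CARD('b) * (\<Prod>f\<in>S. 1 - 1 / real CARD('a) ^ ((length vs - length ws) * degree f))"
      using S(2) monic P len dvd
      by (intro card_avoiding S(1) submod_gen submod_range_pact base_subset_gen card_gen_range_pact finite_UNIV)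
         (auto simp: P_def)
    ultimately show "real (card {w. P (w # ws)}) =
      real CARD('b) * (\<Prod>f\<in>S. 1 - 1 / real CARD('a) ^ ((length vs - length ws) * degree f))" by simp
  qed (auto simp: P_def)
  ultimately show ?thesis by simp
qed

text \<open>A polynomial acts as its remainder modulo g, so the powers of T below deg g
  suffice.\<close>

lemma sum_powers_surj:
  assumes ws: "gen {0} ws = UNIV"
  shows "\<exists>u. (\<forall>i. u i \<in> span (set ws)) \<and> v = (\<Sum>i<degree g. (T ^^ i) (u i))"
proof -
  define D where "D v \<longleftrightarrow> (\<exists>u. (\<forall>i. u i \<in> span (set ws)) \<and> v = (\<Sum>i<degree g. (T ^^ i) (u i)))" for v
  have T_pow: "(T ^^ i) (x + y) = (T ^^ i) x + (T ^^ i) y" "(T ^^ i) 0 = 0"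
    "(T ^^ i) (scale a x) = scale a ((T ^^ i) x)" for i x y a
    by (induction i) (auto simp: T_add T_scale T_0)
  have D_add: "D (x + y)" if x: "D x" and y: "D y" for x y
  proof -
    obtain u where u: "\<forall>i. u i \<in> span (set ws)" "x = (\<Sum>i<degree g. (T ^^ i) (u i))"
      using x unfolding D_def by blast
    obtain u' where "\<forall>i. u' i \<in> span (set ws)" "y = (\<Sum>i<degree g. (T ^^ i) (u' i))"
      using y unfolding D_def by blast
    with u show ?thesis unfolding D_def
      by (intro exI[of _ "\<lambda>i. u i + u' i"]) (auto simp: T_pow sum.distrib span_add)
  qed
  have D_pact: "D (pact p w)" if w: "w \<in> span (set ws)" for p w
  proof -
    have "pact p w = pact (p mod g + p div g * g) w" by simp
    also have "\<dots> = pact (p mod g) w" by (simp only: pact_add pact_mult pact_g pact_zero_right add_0_right)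
    also have "\<dots> = (\<Sum>i<degree g. (T ^^ i) (scale (coeff (p mod g) i) w))"
      using pact_eq_sum[OF mod_in_polys_below[OF g_nonzero]] by (simp add: T_pow)
    finally show ?thesis unfolding D_def
      using w by (intro exI[of _ "\<lambda>i. scale (coeff (p mod g) i) w"]) (auto simp: span_scale)
  qed
  have "gen {0} ws' \<subseteq> Collect D" if "set ws' \<subseteq> set ws" for ws'
    using that
  proof (induction ws')
    case Nil
    have "D 0" using D_pact[OF span_zero, of 0] by simp
    then show ?case by simp
  next
    case (Cons w ws')
    then show ?case by (auto intro!: D_add D_pact span_base)
  qed
  from this[of ws] have "D v" using ws by auto
  then show ?thesis unfolding D_def .
qed

text \<open>With d = deg g, the surjective sum map gives |V| \<le> |W|^d, while |W| \<le> q^m and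
  |V| = q^(m d). Equality throughout makes the sum map injective, which is uniqueness of
  decompositions, and forces dim W = m.\<close>

lemma splitting_span_if_generating:
  assumes d: "0 < degree g" and ws: "length ws = length vs" "gen {0} ws = UNIV"
  shows "splitting_subspace scale T (length vs) (degree g) (span (set ws))"
proof -
  let ?W = "span (set ws)" and ?d = "degree g" and ?m = "length vs"
  let ?X = "\<Pi>\<^sub>E i\<in>{..<?d}. (T ^^ i) ` ?W"
  have finX: "finite ?X" by (intro finite_PiE) auto
  have surj: "(\<lambda>w. \<Sum>i<?d. w i) ` ?X = UNIV"
  proof (intro equalityI subsetI)
    fix v
    obtain u where u: "\<forall>i. u i \<in> ?W" "v = (\<Sum>i<?d. (T ^^ i) (u i))"
      using sum_powers_surj[OF ws(2)] by blast
    have "restrict (\<lambda>i. (T ^^ i) (u i)) {..<?d} \<in> ?X" using u by auto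
    moreover have "v = (\<Sum>i<?d. restrict (\<lambda>i. (T ^^ i) (u i)) {..<?d} i)" using u by simp
    ultimately show "v \<in> (\<lambda>w. \<Sum>i<?d. w i) ` ?X" by blast
  qed simp
  have "card ?X = (\<Prod>i<?d. card ((T ^^ i) ` ?W))" by (simp add: card_PiE)
  also have "\<dots> \<le> (\<Prod>i<?d. card ?W)" by (intro prod_mono) (auto intro: card_image_le)
  finally have X_le: "card ?X \<le> card ?W ^ ?d" by simp
  have W_le: "card ?W \<le> CARD('a) ^ ?m" using card_span_le[of ws] ws by simp
  have UNIV_le: "CARD('b) \<le> card ?X" using card_image_le[OF finX, of "\<lambda>w. \<Sum>i<?d. w i"] surj by simp
  have card: "CARD('b) = (CARD('a) ^ ?m) ^ ?d" by (simp add: card_space power_mult)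
  have W_eq: "card ?W = CARD('a) ^ ?m"
  proof (rule ccontr)
    assume "card ?W \<noteq> CARD('a) ^ ?m"
    then have "card ?W ^ ?d < (CARD('a) ^ ?m) ^ ?d" using W_le d by (intro power_strict_mono) auto
    then show False using X_le UNIV_le card by simp
  qed
  have "card ?X = CARD('b)" using X_le UNIV_le card W_eq by simp
  then have inj: "inj_on (\<lambda>w. \<Sum>i<?d. w i) ?X"
    using surj by (intro eq_card_imp_inj_on finX) simp
  have "is_direct_sum ?d (\<lambda>i. (T ^^ i) ` ?W)"
    unfolding is_direct_sum_def
  proof
    fix v
    have "v \<in> (\<lambda>w. \<Sum>i<?d. w i) ` ?X" using surj by simp
    then obtain w where w: "w \<in> ?X" "v = (\<Sum>i<?d. w i)" by (auto simp only: image_iff)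
    show "\<exists>!w. w \<in> ?X \<and> v = (\<Sum>i<?d. w i)"
    proof (rule ex1I[of _ w])
      show "w \<in> ?X \<and> v = (\<Sum>i<?d. w i)" using w by simp
    next
      fix w' assume "w' \<in> ?X \<and> v = (\<Sum>i<?d. w' i)"
      then show "w' = w" using w inj_onD[OF inj] by metis
    qed
  qed
  moreover have "dim ?W = ?m"
    using card_subspace[OF subspace_span, of "set ws"] W_eq power_inject_exp[OF CARD_field_gt_1] by simp
  ultimately show ?thesis by (simp add: splitting_subspace_def del: dim_span)
qed

text \<open>The submodule generated by \<open>ws\<close> contains W and is T-stable, so it contains
  every summand T^i W.\<close>

lemma generating_if_splitting:
  assumes W: "splitting_subspace scale T m d (span (set ws))"
  shows "gen {0} ws = UNIV"
proof -
  note M = submod_gen[OF submod_singleton, of ws]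
  have W_sub: "span (set ws) \<subseteq> gen {0} ws"
    using M set_subset_gen[OF submod_singleton] by (intro span_minimal) (auto simp: submod_def)
  have T_pow: "(T ^^ i) x \<in> gen {0} ws" if "x \<in> gen {0} ws" for i x
    using that M by (induction i) (auto simp: submod_def)
  have "v \<in> gen {0} ws" for v
  proof -
    obtain w where w: "w \<in> (\<Pi>\<^sub>E i\<in>{..<d}. (T ^^ i) ` span (set ws))" "v = (\<Sum>i<d. w i)"
      using W unfolding splitting_subspace_def is_direct_sum_def by blast
    have "w i \<in> gen {0} ws" if "i < d" for i
    proof -
      have "w i \<in> (T ^^ i) ` span (set ws)" using w(1) that by (auto simp: PiE_iff)
      then show ?thesis using T_pow W_sub by auto
    qed
    then have "(\<Sum>i<d. w i) \<in> gen {0} ws"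
      using M by (intro subspace_sum) (auto simp: submod_def)
    then show ?thesis using w(2) by simp
  qed
  then show ?thesis by auto
qed

lemma card_splitting_mult_gamma:
  assumes d: "0 < degree g"
  shows "real (card {W. splitting_subspace scale T (length vs) (degree g) W}) * gamma CARD('a) (length vs) =
    real (card {ws. length ws = length vs \<and> gen {0} ws = UNIV})"
proof -
  let ?m = "length vs"
  let ?S = "{W. splitting_subspace scale T ?m (degree g) W}"
  let ?L = "\<lambda>W. {ws. length ws = ?m \<and> span (set ws) = W}"
  have sub: "subspace W \<and> dim W = ?m" if "W \<in> ?S" for W
    using that by (simp add: splitting_subspace_def)
  have eq: "{ws. length ws = ?m \<and> gen {0} ws = UNIV} = (\<Union>W\<in>?S. ?L W)"
    using splitting_span_if_generating[OF d] generating_if_splitting by auto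
  have finS: "finite ?S"
    by (rule finite_subset[of _ "Pow UNIV"]) (auto simp del: Pow_UNIV)
  have "card (\<Union>W\<in>?S. ?L W) = (\<Sum>W\<in>?S. card (?L W))"
    using finS card_spanning_lists(2) sub by (intro card_UN_disjoint) auto
  then have "real (card {ws. length ws = ?m \<and> gen {0} ws = UNIV}) = (\<Sum>W\<in>?S. real (card (?L W)))"
    unfolding eq by simp
  also have "\<dots> = (\<Sum>W\<in>?S. gamma CARD('a) ?m)"
    using card_spanning_lists(1) sub by (intro sum.cong) auto
  finally show ?thesis by simp
qed

lemma card_splitting:
  assumes d: "0 < degree g"
    and S: "finite S" "\<And>f. f \<in> S \<Longrightarrow> irreducible f" "g = (\<Prod>f\<in>S. f ^ k f)" "\<And>f. f \<in> S \<Longrightarrow> 0 < k f"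
    and monic: "\<And>f. f \<in> S \<Longrightarrow> lead_coeff f = 1"
  shows "real (card {W. splitting_subspace scale T (length vs) (degree g) W}) =
    real CARD('a) ^ ((length vs)\<^sup>2 * degree g) / gamma CARD('a) (length vs) *
    (\<Prod>f\<in>S. \<Prod>j=1..length vs. 1 - 1 / real CARD('a) ^ (j * degree f))"
proof -
  let ?m = "length vs"
  let ?h = "\<lambda>j f. 1 - 1 / real CARD('a) ^ (j * degree f)"
  have "(\<Prod>i<?m. real CARD('b) * (\<Prod>f\<in>S. ?h (?m - i) f)) =
      real CARD('b) ^ ?m * (\<Prod>i<?m. \<Prod>f\<in>S. ?h (?m - i) f)"
    by (simp add: prod.distrib)
  also have "(\<Prod>i<?m. \<Prod>f\<in>S. ?h (?m - i) f) = (\<Prod>j=1..?m. \<Prod>f\<in>S. ?h j f)"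
    by (rule prod.reindex_bij_witness[of _ "\<lambda>j. ?m - j" "\<lambda>i. ?m - i"]) auto
  also have "\<dots> = (\<Prod>f\<in>S. \<Prod>j=1..?m. ?h j f)" by (rule prod.swap)
  also have "real CARD('b) ^ ?m = real CARD('a) ^ (?m\<^sup>2 * degree g)"
    by (simp add: card_space power2_eq_square ac_simps flip: power_mult)
  finally have "real (card {W. splitting_subspace scale T ?m (degree g) W}) * gamma CARD('a) ?m =
    real CARD('a) ^ (?m\<^sup>2 * degree g) * (\<Prod>f\<in>S. \<Prod>j=1..?m. ?h j f)"
    using card_splitting_mult_gamma[OF d] card_generating_lists[OF S monic] by simp
  moreover have "gamma CARD('a) ?m \<noteq> 0"
    using CARD_field_gt_1 by (auto simp: gamma_def)
  ultimately show ?thesis by (simp add: divide_simps)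
qed

end

section \<open>Invariant factors\<close>

lemma mat_mult_mat:
  "Matrix.mat n n (\<lambda>(i, j). a i j) * Matrix.mat n n (\<lambda>(i, j). b i j) =
   Matrix.mat n n (\<lambda>(i, j). \<Sum>l<n. a i l * b l j)" for a b :: "nat \<Rightarrow> nat \<Rightarrow> 'a::semiring_0"
  by (rule eq_matI) (auto simp: scalar_prod_def lessThan_atLeast0)

lemma invertible_mat_if_sums:
  fixes a b :: "nat \<Rightarrow> nat \<Rightarrow> 'a::semiring_1"
  assumes "\<And>i j. i < n \<Longrightarrow> j < n \<Longrightarrow> (\<Sum>l<n. a i l * b l j) = (if i = j then 1 else 0)"
    and "\<And>i j. i < n \<Longrightarrow> j < n \<Longrightarrow> (\<Sum>l<n. b i l * a l j) = (if i = j then 1 else 0)"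
  shows "invertible_mat (Matrix.mat n n (\<lambda>(i, j). a i j))"
  unfolding invertible_mat_def inverts_mat_def
proof (intro conjI exI[of _ "Matrix.mat n n (\<lambda>(i, j). b i j)"])
  show "square_mat (Matrix.mat n n (\<lambda>(i, j). a i j))" by simp
  show "Matrix.mat n n (\<lambda>(i, j). a i j) * Matrix.mat n n (\<lambda>(i, j). b i j) =
      1\<^sub>m (dim_row (Matrix.mat n n (\<lambda>(i, j). a i j)))"
    unfolding mat_mult_mat by (rule eq_matI) (auto simp: assms(1))
  show "Matrix.mat n n (\<lambda>(i, j). b i j) * Matrix.mat n n (\<lambda>(i, j). a i j) =
      1\<^sub>m (dim_row (Matrix.mat n n (\<lambda>(i, j). b i j)))"
    unfolding mat_mult_mat by (rule eq_matI) (auto simp: assms(2))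
qed

text \<open>The matrix of multiplication by \<open>x\<close> on \<open>(F[x]/(g))\<^sup>m\<close>: basis vector \<open>i * m + j\<close> is \<open>x\<^sup>i\<close> in
  the \<open>j\<close>-th summand.\<close>

definition block_companion :: "nat \<Rightarrow> 'a::field poly \<Rightarrow> nat \<Rightarrow> nat \<Rightarrow> 'a" where
  "block_companion m g i j =
     (if j < m * (degree g - 1) then (if i = j + m then 1 else 0)
      else if i mod m = j - m * (degree g - 1) then - coeff g (i div m) else 0)"

text \<open>The inverse of the matrix whose first \<open>k\<close> columns \<open>x e\<^bsub>c\<^esub> - e\<^bsub>c+m\<^esub>\<close> are those of \<open>xI - A\<close> and
  whose last \<open>m\<close> columns are \<open>e\<^bsub>0\<^esub>, \<dots>, e\<^bsub>m-1\<^esub>\<close>; these equations give the recursion on the column \<open>c\<close>.\<close>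

function smith_row :: "nat \<Rightarrow> nat \<Rightarrow> nat \<Rightarrow> nat \<Rightarrow> 'a::field poly" where
  "smith_row m k i c =
     (if c < m \<or> m = 0 then (if i = k + c then 1 else 0)
      else [:0, 1:] * smith_row m k i (c - m) - (if i = c - m then 1 else 0))"
  by auto
termination by (relation "measure (\<lambda>(m, k, i, c). c)") auto

declare smith_row.simps [simp del]

text \<open>This matrix is also what remains of (xI - A) Q, for the Q constructed below, once the
  factor g is taken out of the last m columns. Its inverse \<open>smith_row\<close> therefore serves
  as the left factor P.\<close>

definition smith_row_inverse :: "nat \<Rightarrow> nat \<Rightarrow> nat \<Rightarrow> nat \<Rightarrow> 'a::field poly" where
  "smith_row_inverse m k i j =
     (if j < k then (if i = j then [:0, 1:] else 0) - (if i = j + m then 1 else 0)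
      else if i = j - k then 1 else 0)"

text \<open>In one order the product restates the recursion, read at column j + m. In the other
  order it follows by induction on the column, from c - m to c.\<close>

lemma smith_row_mult_inverse:
  assumes "0 < m" and n: "n = k + m"
  shows "i < n \<Longrightarrow> j < n \<Longrightarrow>
      (\<Sum>l<n. smith_row m k i l * smith_row_inverse m k l j) = (if i = j then 1 else (0 :: 'a::field poly))"
    and "i < n \<Longrightarrow> j < n \<Longrightarrow>
      (\<Sum>l<n. smith_row_inverse m k i l * smith_row m k l j) = (if i = j then 1 else (0 :: 'a::field poly))"
proof -
  let ?r = "smith_row_inverse m k :: nat \<Rightarrow> nat \<Rightarrow> 'a poly"
  note r_def = smith_row_inverse_def
  have PR: "(\<Sum>l<n. smith_row m k i l * ?r l j) = (if i = j then 1 else 0)" if ij: "i < n" "j < n" for i j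
  proof (cases "j < k")
    case True
    have "(\<Sum>l<n. smith_row m k i l * ?r l j) =
        (\<Sum>l<n. (if l = j then smith_row m k i l * [:0, 1:] else 0) - (if l = j + m then smith_row m k i l else 0))"
      using True by (intro sum.cong) (auto simp: r_def algebra_simps)
    also have "\<dots> = smith_row m k i j * [:0, 1:] - smith_row m k i (j + m)"
      using True ij n by (simp add: sum_subtractf)
    also have "\<dots> = (if i = j then 1 else 0)"
      using assms(1) by (subst (2) smith_row.simps) (simp add: mult.commute)
    finally show ?thesis .
  next
    case False
    have "(\<Sum>l<n. smith_row m k i l * ?r l j) = (\<Sum>l<n. if l = j - k then smith_row m k i l else 0)"
      using False by (intro sum.cong) (auto simp: r_def)
    also have "\<dots> = smith_row m k i (j - k)" using ij by simp
    also have "\<dots> = (if i = j then 1 else 0)"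
      using False ij n by (subst smith_row.simps) auto
    finally show ?thesis .
  qed
  have RP: "(\<Sum>l<n. ?r i l * smith_row m k l c) = (if i = c then 1 else 0)" if "i < n" "c < n" for i c
    using that(2)
  proof (induction c rule: less_induct)
    case (less c)
    show ?case
    proof (cases "c < m")
      case True
      have "(\<Sum>l<n. ?r i l * smith_row m k l c) = (\<Sum>l<n. if l = k + c then ?r i l else 0)"
        using True by (intro sum.cong) (auto simp: smith_row.simps[of m k _ c])
      also have "\<dots> = (if i = c then 1 else 0)" using True n by (simp add: r_def)
      finally show ?thesis .
    next
      case False
      have IH: "(\<Sum>l<n. ?r i l * smith_row m k l (c - m)) = (if i = c - m then 1 else 0)"
        using less False assms(1) by auto
      have "(\<Sum>l<n. ?r i l * smith_row m k l c) =
          (\<Sum>l<n. [:0, 1:] * (?r i l * smith_row m k l (c - m)) - (if l = c - m then ?r i l else 0))"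
        using False assms(1) by (intro sum.cong refl, subst smith_row.simps) (simp add: algebra_simps)
      also have "\<dots> = [:0, 1:] * (\<Sum>l<n. ?r i l * smith_row m k l (c - m)) - ?r i (c - m)"
      proof -
        have "(\<Sum>l<n. if l = c - m then ?r i l else 0) = ?r i (c - m)" using less.prems by simp
        then show ?thesis by (simp only: sum_subtractf sum_distrib_left)
      qed
      also have "\<dots> = (if i = c then 1 else 0)"
        unfolding IH using False less.prems n by (auto simp: r_def)
      finally show ?thesis .
    qed
  qed
  show "i < n \<Longrightarrow> j < n \<Longrightarrow> (\<Sum>l<n. smith_row m k i l * ?r l j) = (if i = j then 1 else 0)"
    and "i < n \<Longrightarrow> j < n \<Longrightarrow> (\<Sum>l<n. ?r i l * smith_row m k l j) = (if i = j then 1 else 0)"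
    using PR RP by blast+
qed

text \<open>Column operations Q clear the last m columns of xI - A down to g in one row each; the
  row operations P then invert what is left after division by the diagonal.\<close>

lemma invariant_factors_block_companion:
  fixes g :: "'a::field poly"
  assumes m: "0 < m" and g: "lead_coeff g = 1" "0 < degree g"
  shows "is_invariant_factors
    (char_poly_matrix (Matrix.mat (m * degree g) (m * degree g) (\<lambda>(i, j). block_companion m g i j)))
    (replicate (m * (degree g - 1)) 1 @ replicate m g)"
proof -
  define k n where "k = m * (degree g - 1)" and "n = m * degree g"
  have n: "n = k + m" using g(2) by (cases "degree g") (auto simp: k_def n_def)
  let ?fs = "replicate k 1 @ replicate m g" and ?X = "[:0, 1:] :: 'a poly"
  let ?A = "Matrix.mat n n (\<lambda>(i, j). block_companion m g i j)"
  have bc: "block_companion m g i j = (if j < k then (if i = j + m then 1 else 0)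
      else if i mod m = j - k then - coeff g (i div m) else 0)" for i j
    by (simp add: block_companion_def k_def)
  define M where "M i j = (if i = j then ?X else 0) - [:block_companion m g i j:]" for i j
  have M: "char_poly_matrix ?A = Matrix.mat n n (\<lambda>(i, j). M i j)"
    by (rule eq_matI) (auto simp: char_poly_matrix_def M_def)
  let ?r = "smith_row_inverse m k :: nat \<Rightarrow> nat \<Rightarrow> 'a poly"
  note smith = smith_row_mult_inverse[OF m n, where 'a = 'a]
  have inv_P: "invertible_mat (Matrix.mat n n (\<lambda>(i, j). smith_row m k i j :: 'a poly))"
    by (rule invertible_mat_if_sums[where b = ?r]) (fact smith)+
  \<comment> \<open>The shifts of g are its Horner quotients. Weighting the rows of one residue
    class modulo m with them makes the product with xI - A telescope by \<open>shift\<close>,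
    leaving only g in row j - k.\<close>
  define h where "h i j = (if i mod m = j - k then poly_shift (Suc (i div m)) g else 0)" for i j
  define N where "N i j = (if i < k \<and> k \<le> j then h i j else 0)" for i j
  have shift: "poly_shift i g = [:coeff g i:] + ?X * poly_shift (Suc i) g" for i
    by (rule poly_eqI) (auto simp: coeff_pCons coeff_poly_shift split: nat.splits)
  have shift_deg: "poly_shift (degree g) g = 1"
    using g(1) by (intro poly_eqI) (auto simp: coeff_poly_shift coeff_1 coeff_eq_0)
  \<comment> \<open>g is monic, so its last Horner quotient is 1. In the last m rows h is thus an
    identity block, and I + N agrees with h on the last m columns.\<close>
  have h_last: "h l j = (if l = j then 1 else 0)" if "k \<le> l" "l < n" "k \<le> j" "j < n" for l j
  proof -
    have l: "l = m * (degree g - 1) + (l - k)" "l - k < m" using that n by (auto simp: k_def)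
    have "l mod m = l - k" by (subst l(1)) (use l(2) in simp)
    moreover have "l div m = degree g - 1" by (subst l(1)) (use l(2) in simp)
    ultimately show ?thesis using that g(2) shift_deg by (auto simp: h_def)
  qed
  \<comment> \<open>N has nonzero entries only in rows below k and columns from k on, so its square
    vanishes and I - N is the inverse of I + N.\<close>
  have NN: "(\<Sum>l<n. N i l * N l j) = 0" for i j
    by (rule sum.neutral) (auto simp: N_def)
  define Q where "Q i j = (if i = j then 1 else 0) + N i j" for i j
  have delta: "(\<Sum>l<n. (if i = l then 1 else 0) * a l) = a i" "(\<Sum>l<n. a l * (if l = i then 1 else 0)) = a i"
    if "i < n" for i and a :: "nat \<Rightarrow> 'a poly"
    using that by (simp_all add: if_distrib[of "\<lambda>x. x * _"] if_distrib[of "\<lambda>x. _ * x"] cong: if_cong)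
  have inv_Q: "invertible_mat (Matrix.mat n n (\<lambda>(i, j). Q i j))"
    by (rule invertible_mat_if_sums[where b = "\<lambda>i j. (if i = j then 1 else 0) - N i j"])
      (simp_all only: Q_def ring_distribs sum.distrib sum_subtractf delta NN,
        simp_all add: algebra_simps)
  have MQ: "(\<Sum>l<n. M i l * Q l j) = ?r i j * ?fs ! j" if ij: "i < n" "j < n" for i j
  proof (cases "j < k")
    case True
    have "(\<Sum>l<n. M i l * Q l j) = (\<Sum>l<n. M i l * (if l = j then 1 else 0))"
      using True by (intro sum.cong) (auto simp: Q_def N_def)
    also have "\<dots> = M i j" using ij by (simp add: delta)
    also have "\<dots> = ?r i j * ?fs ! j"
      using True ij by (auto simp: smith_row_inverse_def M_def bc nth_append one_pCons)
    finally show ?thesis .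
  next
    case False
    have Q: "Q l j = h l j" if "l < n" for l
      using False that ij h_last[of l j] by (auto simp: Q_def N_def)
    have "(\<Sum>l<n. M i l * Q l j) = (\<Sum>l<n. M i l * h l j)" by (intro sum.cong) (auto simp: Q)
    \<comment> \<open>Only three values of l count: the diagonal entry x at l = i, the entry -1 of
      the shift at l = i - m, and the column l = j carrying the coefficients of g. The guard m \<le>
      i is there because i - m is truncated at 0.\<close>
    also have "\<dots> = (\<Sum>l<n. (if l = i then ?X * h l j else 0)
        - (if l = i - m then (if m \<le> i then h l j else 0) else 0)
        - (if l = j then [:if i mod m = j - k then - coeff g (i div m) else 0:] else 0))"
    proof (intro sum.cong refl)
      fix l assume l: "l \<in> {..<n}"
      have "[:block_companion m g i l:] * h l j =
          (if l = i - m then (if m \<le> i then h l j else 0) else 0)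
        + (if l = j then [:if i mod m = j - k then - coeff g (i div m) else 0:] else 0)"
      proof (cases "l < k")
        case True
        then have "l \<noteq> j" using False by simp
        with True show ?thesis by (auto simp: bc one_pCons)
      next
        case nk: False
        then have "\<not> (l = i - m \<and> m \<le> i)" using ij n by auto
        with nk False ij l show ?thesis
          by (auto simp: bc h_last one_pCons)
      qed
      then show "M i l * h l j = (if l = i then ?X * h l j else 0)
        - (if l = i - m then (if m \<le> i then h l j else 0) else 0)
        - (if l = j then [:if i mod m = j - k then - coeff g (i div m) else 0:] else 0)"
        unfolding M_def by (simp only: left_diff_distrib) auto
    qed
    also have "\<dots> = ?X * h i j - (if m \<le> i then h (i - m) j else 0)
        - [:if i mod m = j - k then - coeff g (i div m) else 0:]"
      using ij less_imp_diff_less[of i n m] by (simp add: sum_subtractf)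
    also have "\<dots> = (if i = j - k then g else 0)"
    proof (cases "m \<le> i")
      case True
      have "(i - m) mod m = i mod m" "Suc ((i - m) div m) = i div m"
        using True m by (simp_all add: le_mod_geq le_div_geq)
      then show ?thesis
        using True ij n shift[of "i div m"] by (auto simp: h_def algebra_simps)
    next
      case False
      then show ?thesis using shift[of 0] by (auto simp: h_def algebra_simps)
    qed
    also have "\<dots> = ?r i j * ?fs ! j" using False ij n by (auto simp: smith_row_inverse_def nth_append)
    finally show ?thesis .
  qed
  have "Matrix.mat n n (\<lambda>(i, j). smith_row m k i j) * char_poly_matrix ?A * Matrix.mat n n (\<lambda>(i, j). Q i j) =
      Matrix.mat n n (\<lambda>(i, j). smith_row m k i j) * Matrix.mat n n (\<lambda>(i, j). ?r i j * ?fs ! j)"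
    unfolding M by (subst assoc_mult_mat[of _ n n _ n _ n])
      (auto simp: mat_mult_mat MQ intro!: arg_cong[of _ _ "(*) _"] cong: cong_mat)
  also have "\<dots> = mat_diag n (\<lambda>i. ?fs ! i)"
    unfolding mat_mult_mat mat_diag_def
    by (rule cong_mat) (auto simp: smith(1) mult.assoc[symmetric] simp flip: sum_distrib_right)
  finally have "Matrix.mat n n (\<lambda>(i, j). smith_row m k i j) * char_poly_matrix ?A * Matrix.mat n n (\<lambda>(i, j). Q i j) =
      mat_diag n (\<lambda>i. ?fs ! i)" .
  moreover have "length ?fs = n" using n by simp
  moreover have "?fs ! i dvd ?fs ! Suc i" if "Suc i < n" for i
    using that n by (auto simp: nth_append)
  ultimately have "is_invariant_factors (char_poly_matrix ?A) ?fs"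
    unfolding is_invariant_factors_def using inv_P inv_Q g(1)
    by (intro conjI exI[of _ "Matrix.mat n n (\<lambda>(i, j). smith_row m k i j)"] exI[of _ "Matrix.mat n n (\<lambda>(i, j). Q i j)"])
       auto
  then show ?thesis by (simp add: k_def n_def)
qed

section \<open>Existence of an operator with the given invariant factors, and generators obtained
  from them\<close>

context vector_space
begin

lemma ex_linear_on_basis_list:
  assumes bs: "distinct bs" "independent (set bs)"
  shows "\<exists>T. Vector_Spaces.linear scale scale T \<and> (\<forall>j<length bs. T (bs ! j) = c j)"
proof -
  interpret vector_space_pair scale scale by unfold_locales
  define f where "f b = the (map_of (zip bs (map c [0..<length bs])) b)" for b
  obtain T where T: "Vector_Spaces.linear scale scale T" "\<forall>x\<in>set bs. T x = f x"
    using linear_independent_extend[OF bs(2)] by blast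
  have "f (bs ! j) = c j" if "j < length bs" for j
    using that bs(1) by (simp add: f_def map_of_zip_nth)
  then show ?thesis using T by (intro exI[of _ T]) simp
qed

text \<open>Needed for \<open>sigma\<close>: its description determines a number only if some
  operator has these invariant factors.\<close>

lemma ex_has_invariant_tuple:
  fixes g :: "'a poly"
  assumes "0 < m" and g: "lead_coeff g = 1" "0 < degree g" and dim: "dim UNIV = m * degree g"
  shows "\<exists>T. has_invariant_tuple scale m (degree g) (replicate m g) T"
proof -
  obtain B where B: "independent B" "span B = UNIV" "card B = m * degree g"
    using basis_exists[of UNIV] dim by (metis top.extremum_uniqueI)
  \<comment> \<open>An infinite set has \<open>card\<close> 0, whereas m * deg g is
    positive.\<close>
  have "finite B" using B(3) assms by (auto intro: card_ge_0_finite)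
  then obtain bs where bs: "set bs = B" "distinct bs" using finite_distinct_list by blast
  have len: "length bs = m * degree g" using bs B(3) distinct_card by metis
  let ?A = "Matrix.mat (m * degree g) (m * degree g) (\<lambda>(i, j). block_companion m g i j)"
  obtain T where T: "Vector_Spaces.linear scale scale T"
    "\<And>j. j < length bs \<Longrightarrow> T (bs ! j) = (\<Sum>i<length bs. scale (block_companion m g i j) (bs ! i))"
    using ex_linear_on_basis_list[of bs "\<lambda>j. \<Sum>i<length bs. scale (block_companion m g i j) (bs ! i)"] bs B
    by blast
  have "matrix_of_operator scale bs T ?A"
    unfolding matrix_of_operator_def using bs B len T(2) by auto
  then show ?thesis
    using invariant_factors_block_companion[OF assms(1) g] T(1)
    unfolding has_invariant_tuple_def operator_invariant_factors_def by blast
qed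

end

text \<open>As an F[x]-module, V is generated by the basis with the columns of xI - A as relations.
  The Smith form turns the basis into a generating family whose j-th member is killed by the j-th
  invariant factor.\<close>

lemma (in operator_space) generators_if_invariant_factors:
  assumes A: "matrix_of_operator scale bs T A"
    and fs: "is_invariant_factors (char_poly_matrix A) (replicate k 1 @ replicate m g)"
  shows "\<exists>vs. length vs = m \<and> gen {0} vs = UNIV \<and> (\<forall>v. pact g v = 0)"
proof -
  let ?fs = "replicate k 1 @ replicate m g"
  let ?M = "char_poly_matrix A"
  define n where "n = k + m"
  note A' = A[unfolded matrix_of_operator_def]
  have n: "length bs = n" and Acar: "A \<in> carrier_mat n n"
    using A' fs unfolding is_invariant_factors_def n_def by (auto simp: char_poly_matrix_def)
  have M: "?M \<in> carrier_mat n n" using Acar by simp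
  obtain P Q where P: "P \<in> carrier_mat n n" "invertible_mat P" and Q: "Q \<in> carrier_mat n n"
    and PMQ: "P * ?M * Q = mat_diag n (\<lambda>i. ?fs ! i)"
    using fs unfolding is_invariant_factors_def n_def by auto
  obtain R where "P * R = 1\<^sub>m n" "R * P = 1\<^sub>m (dim_row R)"
    using P unfolding invertible_mat_def inverts_mat_def by auto
  then have RP: "R * P = 1\<^sub>m n" and R: "R \<in> carrier_mat n n"
    using P(1) by (metis carrier_matD carrier_matI index_mult_mat(2,3) index_one_mat(2,3))+
  have "R * (P * ?M * Q) = (R * P) * (?M * Q)"
    using P Q M R by (simp add: assoc_mult_mat[of _ n n _ n _ n])
  then have MQ: "?M * Q = R * mat_diag n (\<lambda>i. ?fs ! i)"
    using PMQ RP M Q by simp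
  \<comment> \<open>The new family. With R inverse to P and D the diagonal matrix, P M Q = D becomes
    M Q = R D, so the j-th factor applied to r j has a column of M Q as coefficients: a combination
    of the relations.\<close>
  define r where "r j = (\<Sum>i<n. pact (R $$ (i, j)) (bs ! i))" for j
  \<comment> \<open>A column of xI - A states that x acts on the j-th basis vector as T
    does.\<close>
  have rel: "(\<Sum>i<n. pact (?M $$ (i, j)) (bs ! i)) = 0" if j: "j < n" for j
  proof -
    have "pact (?M $$ (i, j)) (bs ! i) = (if i = j then T (bs ! i) else 0) - scale (A $$ (i, j)) (bs ! i)"
      if "i < n" for i
      using that j Acar by (simp add: char_poly_matrix_def T_0 T_add)
    then have "(\<Sum>i<n. pact (?M $$ (i, j)) (bs ! i)) = T (bs ! j) - (\<Sum>i<n. scale (A $$ (i, j)) (bs ! i))"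
      using j by (simp add: sum_subtractf)
    then show ?thesis using A' j n by simp
  qed
  have r_rel: "pact (?fs ! j) (r j) = 0" if j: "j < n" for j
  proof -
    have "pact (?fs ! j) (r j) = (\<Sum>i<n. pact ((R * mat_diag n (\<lambda>i. ?fs ! i)) $$ (i, j)) (bs ! i))"
      using j R by (simp add: r_def pact_sum_right mat_diag_mult_right mult.commute flip: pact_mult)
    also have "\<dots> = (\<Sum>i<n. \<Sum>l<n. pact (Q $$ (l, j)) (pact (?M $$ (i, l)) (bs ! i)))"
      unfolding MQ[symmetric] using j M Q
      by (intro sum.cong) (auto simp: scalar_prod_def pact_sum lessThan_atLeast0 mult.commute simp flip: pact_mult)
    also have "\<dots> = (\<Sum>l<n. pact (Q $$ (l, j)) (\<Sum>i<n. pact (?M $$ (i, l)) (bs ! i)))"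
      by (subst sum.swap) (simp add: pact_sum_right)
    also have "\<dots> = 0" using rel by simp
    finally show ?thesis .
  qed
  \<comment> \<open>R P = 1 recovers the basis from the new family.\<close>
  have b: "bs ! j = (\<Sum>l<n. pact (P $$ (l, j)) (r l))" if j: "j < n" for j
  proof -
    have "(\<Sum>l<n. pact (P $$ (l, j)) (r l)) = (\<Sum>l<n. \<Sum>i<n. pact (R $$ (i, l) * P $$ (l, j)) (bs ! i))"
      by (simp add: r_def pact_sum_right mult.commute flip: pact_mult)
    also have "\<dots> = (\<Sum>i<n. pact ((R * P) $$ (i, j)) (bs ! i))"
      using j R P by (subst sum.swap) (simp add: scalar_prod_def pact_sum lessThan_atLeast0)
    also have "\<dots> = (\<Sum>i<n. if i = j then bs ! i else 0)"
      using j unfolding RP by (intro sum.cong) auto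
    also have "\<dots> = bs ! j" using j by simp
    finally show ?thesis by simp
  qed
  define vs where "vs = map r [k..<n]"
  note G = submod_gen[OF submod_singleton, of vs]
  \<comment> \<open>For l < k the invariant factor is 1, which forces r l = 0; only the last m
    members remain.\<close>
  have r_gen: "r l \<in> gen {0} vs" if "l < n" for l
  proof (cases "l < k")
    case True
    then have "r l = 0" using r_rel[OF that] by (simp add: nth_append)
    then show ?thesis using submod_zero[OF G] by simp
  next
    case False
    then show ?thesis using set_subset_gen[OF submod_singleton, of vs] that by (auto simp: vs_def)
  qed
  have "bs ! j \<in> gen {0} vs" if "j < n" for j
    unfolding b[OF that] using G r_gen by (intro subspace_sum) (auto simp: submod_def intro: submod_pact[OF G])
  then have "set bs \<subseteq> gen {0} vs" using n by (auto simp: in_set_conv_nth)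
  then have "span (set bs) \<subseteq> gen {0} vs" using G by (intro span_minimal) (auto simp: submod_def)
  then have gen: "gen {0} vs = UNIV" using A' by auto
  have "submod {v. pact g v = 0}"
    by (rule submodI) (auto simp: pact_add_right simp flip: pact_mult, simp add: mult.commute[of g] pact_mult)
  then have "gen {0} vs \<subseteq> {v. pact g v = 0}"
  proof (rule gen_least)
    have "pact g (r l) = 0" if "k \<le> l" "l < n" for l
      using r_rel[OF that(2)] that by (simp add: nth_append n_def)
    then show "set vs \<subseteq> {v. pact g v = 0}" by (auto simp: vs_def)
  qed auto
  then show ?thesis using gen by (intro exI[of _ vs]) (auto simp: vs_def n_def)
qed

section \<open>The count for a given operator and the value of \<open>sigma\<close>\<close>

lemma card_splitting_subspaces:
  fixes scale :: "'a::{field,finite} \<Rightarrow> 'v::ab_group_add \<Rightarrow> 'v"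
  assumes vs: "vector_space scale" and dim: "vector_space.dim scale (UNIV :: 'v set) = m * degree g"
    and T: "has_invariant_tuple scale m (degree g) (replicate m g) T"
    and g: "0 < degree g" "g = (\<Prod>f\<in>S. f ^ k f)"
    and S: "finite S" "\<And>f. f \<in> S \<Longrightarrow> irreducible f" "\<And>f. f \<in> S \<Longrightarrow> lead_coeff f = 1" "\<And>f. f \<in> S \<Longrightarrow> 0 < k f"
  shows "real (card {W. splitting_subspace scale T m (degree g) W}) =
    real CARD('a) ^ (m\<^sup>2 * degree g) / gamma CARD('a) m *
    (\<Prod>f\<in>S. \<Prod>j=1..m. 1 - 1 / real CARD('a) ^ (j * degree f))"
proof -
  interpret vector_space scale by (rule vs)
  interpret operator_space scale T
    by (intro operator_space.intro operator_space_axioms.intro vs)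
      (use T in \<open>simp add: has_invariant_tuple_def\<close>)
  obtain vs where vs: "length vs = m" "gen {0} vs = UNIV" "\<And>v. pact g v = 0"
    using T generators_if_invariant_factors
    unfolding has_invariant_tuple_def operator_invariant_factors_def by metis
  have g0: "g \<noteq> 0" using g(1) by auto
  have fin: "finite (UNIV :: 'v set)"
    using gen_card_le[OF submod_singleton _ g0, of vs] vs by simp
  interpret finite_vector_space scale by unfold_locales (rule fin)
  interpret homogeneous_operator scale T g vs
    by unfold_locales (use g0 vs card_subspace[of UNIV] dim in \<open>auto simp: subspace_UNIV\<close>)
  show ?thesis using card_splitting[OF g(1) S(1,2) g(2) S(4,3)] vs(1) by simp
qed

theorem theorem3p7:
  fixes scale :: "'a::{field,finite} \<Rightarrow> 'v::ab_group_add \<Rightarrow> 'v"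
    and m d t :: nat
    and g :: "'a poly"
    and \<phi> :: "nat \<Rightarrow> 'a poly"
    and e \<delta> :: "nat \<Rightarrow> nat"
  assumes "m > 0" and "d > 0"
    and "vector_space scale"
    and "vector_space.dim scale (UNIV :: 'v set) = m * d"
    and "lead_coeff g = 1" and "degree g = d"
    and "g = (\<Prod>i=1..t. \<phi> i ^ e i)"
    and "inj_on \<phi> {1..t}"
    and "\<And>i. i \<in> {1..t} \<Longrightarrow> lead_coeff (\<phi> i) = 1"
    and "\<And>i. i \<in> {1..t} \<Longrightarrow> irreducible (\<phi> i)"
    and "\<And>i. i \<in> {1..t} \<Longrightarrow> degree (\<phi> i) = \<delta> i"
    and "\<And>i. i \<in> {1..t} \<Longrightarrow> e i > 0"
  shows "(\<forall>T. has_invariant_tuple scale m d (replicate m g) T \<longrightarrow>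
            card {W. splitting_subspace scale T m d W} = sigma scale m d (replicate m g)) \<and>
         real (sigma scale m d (replicate m g)) =
           real CARD('a) ^ (m\<^sup>2 * d) / gamma CARD('a) m *
           (\<Prod>i=1..t. \<Prod>j=1..m. 1 - 1 / real CARD('a) ^ (j * \<delta> i))"
proof -
  \<comment> \<open>The indexed factorization becomes a product over the set of factors; injectivity
    of \<phi> assigns each factor its exponent.\<close>
  define S k where "S = \<phi> ` {1..t}" and "k = e \<circ> inv_into {1..t} \<phi>"
  note inj = assms(8)
  have k: "k (\<phi> i) = e i" if "i \<in> {1..t}" for i using that inj by (simp add: k_def)
  have g: "g = (\<Prod>f\<in>S. f ^ k f)"
    unfolding S_def prod.reindex[OF inj] assms(7) by (rule prod.cong) (use k in auto)
  let ?rhs = "real CARD('a) ^ (m\<^sup>2 * d) / gamma CARD('a) m *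
           (\<Prod>i=1..t. \<Prod>j=1..m. 1 - 1 / real CARD('a) ^ (j * \<delta> i))"
  have rhs: "(\<Prod>f\<in>S. \<Prod>j=1..m. 1 - 1 / real CARD('a) ^ (j * degree f)) =
      (\<Prod>i=1..t. \<Prod>j=1..m. 1 - 1 / real CARD('a) ^ (j * \<delta> i))"
    unfolding S_def prod.reindex[OF inj] by (rule prod.cong) (use assms(11) in auto)
  have count: "real (card {W. splitting_subspace scale T m d W}) = ?rhs"
    if "has_invariant_tuple scale m d (replicate m g) T" for T
  proof -
    have "real (card {W. splitting_subspace scale T m (degree g) W}) =
      real CARD('a) ^ (m\<^sup>2 * degree g) / gamma CARD('a) m *
      (\<Prod>f\<in>S. \<Prod>j=1..m. 1 - 1 / real CARD('a) ^ (j * degree f))"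
    proof (rule card_splitting_subspaces[OF assms(3) _ _ _ g])
      show "finite S" by (simp add: S_def)
      show "irreducible f" "lead_coeff f = 1" "0 < k f" if "f \<in> S" for f
        using that assms(9,10,12) k by (auto simp only: S_def)
    qed (use that assms(2,4,6) in simp_all)
    then show ?thesis by (simp only: rhs assms(6))
  qed
  \<comment> \<open>Without such an operator every number would satisfy the description in
    \<open>sigma\<close>.\<close>
  obtain T0 where T0: "has_invariant_tuple scale m d (replicate m g) T0"
    using vector_space.ex_has_invariant_tuple[OF assms(3), of m g] assms(1,2,4-6) by auto
  have same: "card {W. splitting_subspace scale T m d W} = card {W. splitting_subspace scale T0 m d W}"
    if "has_invariant_tuple scale m d (replicate m g) T" for T
    using count[OF that] count[OF T0] by linarith
  have sigma: "sigma scale m d (replicate m g) = card {W. splitting_subspace scale T0 m d W}"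
    unfolding sigma_def
  proof (rule the_equality)
    show "\<forall>T. has_invariant_tuple scale m d (replicate m g) T \<longrightarrow>
      card {W. splitting_subspace scale T m d W} = card {W. splitting_subspace scale T0 m d W}"
      using same by blast
  qed (use T0 in metis)
  show ?thesis unfolding sigma using same count[OF T0] by blast
qed

end
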